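(* Let $d\ge 2$ be an integer. Let $\omega\colon[0,\infty)\to[0,\infty)$ be a continuous, strictly increasing, convex function with $\omega(0)=0$ such that $r\mapsto \omega(r)/r^d$ is monotone decreasing on $(0,\infty)$. Then the following are equivalent: (i) For every set $A\subset\mathbb{R}^d$ and for every function $f\colon A\to\mathbb{R}$ with modulus of continuity $\omega$, the Lebesgue measure of $f(A)$ is zero. (ii) $\int_0^1 \omega(r)^{-1/d}\,dr=\infty$.
   Context: A function $f\colon A\to\mathbb{R}$, $A\subset\mathbb{R}^d$, has modulus of continuity $\omega$ if $|f(x)-f(y)|\le\omega(|x-y|)$ for all $x,y\in A$, where $|x-y|$ is the Euclidean distance. "Monotone decreasing" is meant in the weak sense (non-increasing). "Measure zero" means being a Lebesgue null set in $\mathbb{R}$. *)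

theory Defs
  imports "HOL-Analysis.Analysis"
begin

(* A function on A is represented by a total function; only its values on A matter. *)
definition has_modulus_of_continuity ::
  "('a::metric_space \<Rightarrow> real) \<Rightarrow> 'a set \<Rightarrow> (real \<Rightarrow> real) \<Rightarrow> bool"
  where "has_modulus_of_continuity f A \<omega> \<longleftrightarrow>
    (\<forall>x\<in>A. \<forall>y\<in>A. \<bar>f x - f y\<bar> \<le> \<omega> (dist x y))"

end

theory Submission
  imports Defs
begin

text \<open>
  Let \<open>d\<close> be the dimension. At the dyadic scale \<open>2^-k\<close> put \<open>q k = 2^-k / \<omega> (2^-k)\<close> and
  \<open>h k = 2^-k / \<omega> (2^-k)^(1/d)\<close>. Comparing the integral in (ii) with its values on dyadic intervals,
  (ii) implies that the series of the \<open>h k\<close> diverges.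

  Suppose that \<open>f\<close> has modulus \<open>\<omega>\<close> and an image of positive measure. Passing to the closure of a bounded
  piece, its domain may be taken compact. For a compact subset \<open>X\<close> of the domain let \<open>V k\<close> be the volume
  of the closed neighbourhood of \<open>X\<close> of radius \<open>2^-k\<close>, and let \<open>b k\<close> be the infimum, over all such \<open>X\<close>
  whose image is not null, of \<open>V k\<close> divided by the length of \<open>f ` X\<close>. Cut the range of \<open>f\<close> into windows of
  length \<open>l\<close> comparable to \<open>\<omega> (2^-k)\<close>. Points of \<open>X\<close> whose values are further apart than that have
  distance at least \<open>2^-k\<close>, so the neighbourhood falls into about \<open>|f ` X| / l\<close> pieces, each of volume at
  least about \<open>b l\<close>, and isoperimetry gives each piece a surface of order \<open>(b l)^(1-1/d)\<close>. If these surfaces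
  were all part of the surface of the neighbourhood, then doubling the radius would add the volume
  \<open>h k * (b (k+1))^(1-1/d) * |f ` X|\<close> up to a constant; hence \<open>(b k)^(1/d)\<close> would grow by a multiple of
  \<open>h k\<close> at every scale, and the series of the \<open>h k\<close> would have to converge.

  The difficulty is that pieces with adjacent windows may touch along large interfaces. An interface is part of
  a level set of an extension of \<open>f\<close>, so by the coarea principle the total interface is at most the integral
  of the slope of the extension, divided by \<open>l\<close>. There is an extension whose slope at distance \<open>\<rho>\<close> from \<open>X\<close>
  is of order \<open>\<omega> \<rho> / \<rho>\<close> (\<open>ext_lipschitz\<close>). Integrated over the layers between consecutive dyadic
  neighbourhoods this gives (\<open>growth_inequality\<close>), up to constants,
  \<open>h k * (b (k+1))^(1-1/d) * |f ` X| \<le> V k - V (k+1) + q k * (\<Sum>j\<ge>k. (V j - V (j+1)) / q j)\<close>.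
  Multiplied by the weights \<open>w k = 1 - q k / q (k+1)\<close> the error terms sum to at most a multiple of the volume
  at the coarsest scale, because \<open>w k * q k \<le> q (k+1) - q k\<close> telescopes and \<open>q (k+1) \<le> 2^d * q k\<close>
  (\<open>summed_growth\<close>). The weights cost nothing: \<open>w k\<close> is small only if \<open>h (k+1)\<close> is smaller than \<open>h k\<close> by a
  definite factor, so such scales contribute boundedly little (\<open>share_weight_ge\<close>). Taking the infimum over \<open>X\<close>
  leaves the inequality \<open>(\<Sum>k\<ge>j. w k * h k * (b (k+1))^(1-1/d)) \<le> C * b j\<close> for all \<open>j\<close>, which bounds the
  series of the \<open>w k * h k\<close> (\<open>bounded_sum_of_self_improving\<close>).

  Conversely, if the integral is finite, choose \<open>r j\<close> with \<open>\<omega> (r j)\<close> proportional to \<open>2^-(j d)\<close>; then the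
  series of the \<open>2^j * r j\<close> converges. This leaves enough room for a Cantor set in which a cube of generation
  \<open>j\<close> has side of order \<open>2^-j\<close> and consists of \<open>2^d\<close> smaller cubes separated by gaps \<open>r j\<close>. Map the cubes of
  generation \<open>j\<close> to the intervals of length \<open>2^-(j d)\<close>: the resulting function has modulus \<open>\<omega>\<close>, and its
  image is an interval.
\<close>

section \<open>Convex moduli and an extension adapted to them\<close>

locale modulus =
  fixes \<omega> :: "real \<Rightarrow> real" and d :: nat
  assumes d_ge_2: "d \<ge> 2"
    and cont: "continuous_on {0..} \<omega>"
    and strict: "strict_mono_on {0..} \<omega>"
    and conv: "convex_on {0..} \<omega>"
    and zero [simp]: "\<omega> 0 = 0"
    and ratio: "antimono_on {0<..} (\<lambda>r. \<omega> r / r ^ d)"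
begin

lemma less: "0 \<le> r \<Longrightarrow> r < s \<Longrightarrow> \<omega> r < \<omega> s"
  using strict by (auto simp: strict_mono_on_def)

lemma mono: "0 \<le> r \<Longrightarrow> r \<le> s \<Longrightarrow> \<omega> r \<le> \<omega> s"
  using less[of r s] by (cases "r = s") auto

lemma le_imp_le: "0 \<le> r \<Longrightarrow> 0 \<le> s \<Longrightarrow> \<omega> r \<le> \<omega> s \<Longrightarrow> r \<le> s"
  using less[of s r] by (cases "r \<le> s") auto

lemma pos: "0 < r \<Longrightarrow> 0 < \<omega> r"
  using less[of 0 r] by auto

lemma nonneg: "0 \<le> r \<Longrightarrow> 0 \<le> \<omega> r"
  using mono[of 0 r] by auto

lemma growth:
  assumes "1 \<le> c" "0 \<le> r"
  shows "\<omega> (c * r) \<le> c ^ d * \<omega> r"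
proof (cases "r = 0")
  case False
  with assms have r: "0 < r" "0 < c * r" "r \<le> c * r" by auto
  have "\<omega> (c * r) / (c * r) ^ d \<le> \<omega> r / r ^ d"
    using monotone_onD[OF ratio, of r "c * r"] r by auto
  with r assms show ?thesis by (simp add: field_simps power_mult_distrib)
qed simp

lemma convexD:
  assumes "0 \<le> t" "t \<le> 1" "0 \<le> x" "0 \<le> y"
  shows "\<omega> ((1 - t) * x + t * y) \<le> (1 - t) * \<omega> x + t * \<omega> y"
  using convex_onD[OF conv, of t x y] assms by auto

lemma slope:
  assumes "0 \<le> t" "0 \<le> \<delta>" "\<delta> \<le> \<rho>" "0 < \<rho>"
  shows "\<omega> (t + \<delta>) - \<omega> t \<le> \<delta> / \<rho> * (\<omega> (t + \<rho>) - \<omega> t)"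
proof -
  have "(1 - \<delta> / \<rho>) * t + \<delta> / \<rho> * (t + \<rho>) = t + \<delta>" using assms by (simp add: field_simps)
  with convexD[of "\<delta> / \<rho>" t "t + \<rho>"] assms
  have "\<omega> (t + \<delta>) \<le> (1 - \<delta> / \<rho>) * \<omega> t + \<delta> / \<rho> * \<omega> (t + \<rho>)" by auto
  then show ?thesis by (simp add: algebra_simps)
qed

lemma quotient_mono:
  assumes "0 < r" "r \<le> s"
  shows "\<omega> r / r \<le> \<omega> s / s"
  using slope[of 0 r s] assms by (simp add: field_simps)

lemma double: "0 \<le> r \<Longrightarrow> 2 * \<omega> r \<le> \<omega> (2 * r)"
  using slope[of 0 r "2 * r"] by (cases "r = 0") (auto simp: field_simps)

text \<open>
  McShane's extension with the cone \<open>\<omega> (4 * dist x z)\<close>. The factor 4 makes the cone so steep that the infimum is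
  attained within twice the distance of \<open>z\<close> from \<open>X\<close>; this localises the slope of the extension.
\<close>
definition ext :: "('a::metric_space \<Rightarrow> real) \<Rightarrow> 'a set \<Rightarrow> 'a \<Rightarrow> real" where
  "ext f X z = (INF x\<in>X. f x + \<omega> (4 * dist x z))"

end

locale modulus_function = modulus \<omega> d for \<omega> :: "real \<Rightarrow> real" and d :: nat +
  fixes f :: "'a::euclidean_space \<Rightarrow> real" and X :: "'a set"
  assumes dim: "DIM('a) = d"
    and X: "compact X" "X \<noteq> {}"
    and f: "has_modulus_of_continuity f X \<omega>"
begin

lemma f_le: "x \<in> X \<Longrightarrow> y \<in> X \<Longrightarrow> \<bar>f x - f y\<bar> \<le> \<omega> (dist x y)"
  using f unfolding has_modulus_of_continuity_def by auto

lemma f_le': "x \<in> X \<Longrightarrow> y \<in> X \<Longrightarrow> dist x y \<le> r \<Longrightarrow> \<bar>f x - f y\<bar> \<le> \<omega> r"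
  using f_le[of x y] mono[of "dist x y" r] by auto

lemma cont_omega_dist: "continuous_on S (\<lambda>x. \<omega> (4 * dist x z))"
  by (rule continuous_on_compose2[OF cont]) (auto intro!: continuous_intros)

lemma f_cont: "continuous_on X f"
  unfolding continuous_on_iff
proof safe
  fix x :: 'a and e :: real assume x: "x \<in> X" and e: "(0::real) < e"
  have "\<exists>\<delta>>0. \<forall>y\<in>{0..}. dist y 0 < \<delta> \<longrightarrow> dist (\<omega> y) (\<omega> 0) < e"
    using cont[unfolded continuous_on_iff, rule_format, of 0 e] e by blast
  then obtain \<delta> where \<delta>: "\<delta> > 0" "\<And>y. y \<in> {0..} \<Longrightarrow> dist y 0 < \<delta> \<Longrightarrow> dist (\<omega> y) (\<omega> 0) < e"
    by blast
  have \<delta>': "\<omega> y < e" if "y \<ge> 0" "y < \<delta>" for y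
    using \<delta>(2)[of y] that by (simp add: dist_real_def)
  show "\<exists>\<delta>>0. \<forall>y\<in>X. dist y x < \<delta> \<longrightarrow> dist (f y) (f x) < e"
  proof (intro exI[of _ \<delta>] conjI ballI impI)
    fix y assume "y \<in> X" "dist y x < \<delta>"
    then show "dist (f y) (f x) < e"
      using le_less_trans[OF f_le[of y x] \<delta>'[of "dist y x"]] x by (simp add: dist_real_def)
  qed (rule \<delta>)
qed

lemma ext_attained:
  obtains x where "x \<in> X" "ext f X z = f x + \<omega> (4 * dist x z)"
    "\<And>y. y \<in> X \<Longrightarrow> f x + \<omega> (4 * dist x z) \<le> f y + \<omega> (4 * dist y z)"
proof -
  have "continuous_on X (\<lambda>x. f x + \<omega> (4 * dist x z))"
    by (intro continuous_intros f_cont cont_omega_dist)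
  then obtain x where x: "x \<in> X" "\<And>y. y \<in> X \<Longrightarrow> f x + \<omega> (4 * dist x z) \<le> f y + \<omega> (4 * dist y z)"
    using continuous_attains_inf[OF X] by blast
  have "ext f X z = f x + \<omega> (4 * dist x z)"
    unfolding ext_def using x by (intro cInf_eq_minimum) auto
  then show ?thesis by (rule that[OF x(1) _ x(2)])
qed

lemma ext_le: "y \<in> X \<Longrightarrow> ext f X z \<le> f y + \<omega> (4 * dist y z)"
  by (rule ext_attained[of z]) simp

text \<open>
  A minimiser far away would have to beat the cone at the nearest point \<open>p\<close>. But \<open>f p - f x\<close> is at most
  \<open>\<omega> (2 * dist x z)\<close>, which by convexity is at most half of the height \<open>\<omega> (4 * dist x z)\<close> of its own cone.
\<close>
lemma ext_attained_near:
  obtains x where "x \<in> X" "ext f X z = f x + \<omega> (4 * dist x z)" "dist x z \<le> 2 * infdist z X"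
proof -
  obtain x where x: "x \<in> X" "ext f X z = f x + \<omega> (4 * dist x z)"
    "\<And>y. y \<in> X \<Longrightarrow> f x + \<omega> (4 * dist x z) \<le> f y + \<omega> (4 * dist y z)"
    by (rule ext_attained[of z]) blast
  obtain p where p: "p \<in> X" "infdist z X = dist z p"
    using infdist_attains_inf[of X z] X compact_imp_closed by blast
  have "dist x z \<le> 2 * infdist z X"
  proof (rule ccontr)
    assume far: "\<not> ?thesis"
    have far': "dist x z > 2 * dist z p" using far p by auto
    with zero_le_dist[of z p] have "dist z p \<le> dist x z" by linarith
    have "dist p x \<le> 2 * dist x z"
      using dist_triangle[of p x z] \<open>dist z p \<le> dist x z\<close> by (simp add: dist_commute)
    with p x have "f p - f x \<le> \<omega> (2 * dist x z)"
      using f_le'[of p x] by fastforce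
    moreover have "f x + \<omega> (4 * dist x z) \<le> f p + \<omega> (4 * dist z p)"
      using x(3)[OF p(1)] by (simp add: dist_commute)
    moreover have "2 * \<omega> (2 * dist x z) \<le> \<omega> (4 * dist x z)"
      using double[of "2 * dist x z"] by simp
    ultimately have "\<omega> (2 * dist x z) \<le> \<omega> (4 * dist z p)" by linarith
    then have "2 * dist x z \<le> 4 * dist z p"
      using le_imp_le[of "2 * dist x z" "4 * dist z p"] by simp
    with far' show False by simp
  qed
  then show ?thesis by (rule that[OF x(1,2)])
qed

lemma ext_near:
  assumes "x \<in> X" "dist x z \<le> r"
  shows "\<bar>ext f X z - f x\<bar> \<le> \<omega> (4 * r)"
proof -
  obtain y where y: "y \<in> X" "ext f X z = f y + \<omega> (4 * dist y z)" "dist y z \<le> 2 * infdist z X"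
    by (rule ext_attained_near)
  have r: "0 \<le> r" using assms(2) zero_le_dist[of x z] by linarith
  have "infdist z X \<le> r"
    using infdist_le[of x X z] assms by (auto simp: dist_commute)
  then have "dist x y \<le> 4 * r"
    using dist_triangle[of x y z] y assms r by (auto simp: dist_commute)
  then have "f x - f y \<le> \<omega> (4 * r)" using f_le'[of x y] assms y by fastforce
  moreover have "\<omega> (4 * dist x z) \<le> \<omega> (4 * r)" "0 \<le> \<omega> (4 * dist y z)"
    using assms r by (auto intro: mono nonneg)
  ultimately show ?thesis using ext_le[OF assms(1), of z] y by linarith
qed

text \<open>
  Moving \<open>z\<close> changes the height of the cone over the minimiser \<open>x\<close>. As \<open>x\<close> is within \<open>2 * \<rho>\<close> of \<open>z\<close>, convexity
  bounds the chord of \<open>\<omega>\<close> involved by the steeper one that ends at \<open>12 * \<rho>\<close>.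
\<close>
lemma ext_le_ext:
  assumes "infdist z X \<le> \<rho>" "0 < \<rho>" "dist z z' \<le> \<rho>"
  shows "ext f X z' \<le> ext f X z + dist z z' / \<rho> * \<omega> (12 * \<rho>)"
proof -
  obtain x where x: "x \<in> X" "ext f X z = f x + \<omega> (4 * dist x z)" "dist x z \<le> 2 * infdist z X"
    by (rule ext_attained_near)
  have "4 * dist x z' \<le> 4 * dist x z + 4 * dist z z'"
    using dist_triangle[of x z' z] by simp
  then have "ext f X z' \<le> f x + \<omega> (4 * dist x z + 4 * dist z z')"
    using ext_le[OF x(1), of z'] mono[of "4 * dist x z'" "4 * dist x z + 4 * dist z z'"] by simp
  moreover have "\<omega> (4 * dist x z + 4 * dist z z') - \<omega> (4 * dist x z)
    \<le> 4 * dist z z' / (4 * \<rho>) * (\<omega> (4 * dist x z + 4 * \<rho>) - \<omega> (4 * dist x z))"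
    using assms by (intro slope) auto
  moreover have "4 * dist z z' / (4 * \<rho>) * (\<omega> (4 * dist x z + 4 * \<rho>) - \<omega> (4 * dist x z))
    \<le> dist z z' / \<rho> * \<omega> (12 * \<rho>)"
  proof -
    have "\<omega> (4 * dist x z + 4 * \<rho>) \<le> \<omega> (12 * \<rho>)" "0 \<le> \<omega> (4 * dist x z)"
      using assms x by (auto intro!: mono nonneg)
    then have "\<omega> (4 * dist x z + 4 * \<rho>) - \<omega> (4 * dist x z) \<le> \<omega> (12 * \<rho>)" by linarith
    then have "dist z z' / \<rho> * (\<omega> (4 * dist x z + 4 * \<rho>) - \<omega> (4 * dist x z))
      \<le> dist z z' / \<rho> * \<omega> (12 * \<rho>)"
      using assms(2) by (intro mult_left_mono) auto
    then show ?thesis by simp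
  qed
  ultimately show ?thesis using x by linarith
qed

text \<open>
  The slope of the extension at distance \<open>\<rho>\<close> from \<open>X\<close> is of order \<open>\<omega> \<rho> / \<rho>\<close>. At points closer to \<open>X\<close> the
  larger scale \<open>\<rho>\<close> still gives a valid bound.
\<close>
lemma ext_lipschitz:
  assumes "infdist z X \<le> \<rho>" "0 < \<rho>" "dist z z' \<le> \<rho>"
  shows "\<bar>ext f X z - ext f X z'\<bar> \<le> dist z z' * (24 ^ d * (\<omega> \<rho> / \<rho>))"
proof -
  have "infdist z' X \<le> 2 * \<rho>"
    using infdist_triangle[of z' X z] assms by (simp add: dist_commute)
  then have "ext f X z \<le> ext f X z' + dist z' z / (2 * \<rho>) * \<omega> (12 * (2 * \<rho>))"
    using assms by (intro ext_le_ext) (auto simp: dist_commute)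
  moreover have "dist z z' / \<rho> * \<omega> (12 * \<rho>) \<le> dist z z' / (2 * \<rho>) * \<omega> (24 * \<rho>)"
  proof -
    have "dist z z' / (2 * \<rho>) * (2 * \<omega> (12 * \<rho>)) \<le> dist z z' / (2 * \<rho>) * \<omega> (24 * \<rho>)"
      using double[of "12 * \<rho>"] assms by (intro mult_left_mono) auto
    then show ?thesis by simp
  qed
  moreover have "ext f X z' \<le> ext f X z + dist z z' / \<rho> * \<omega> (12 * \<rho>)"
    by (rule ext_le_ext) (use assms in auto)
  ultimately have "\<bar>ext f X z - ext f X z'\<bar> \<le> dist z z' / (2 * \<rho>) * \<omega> (24 * \<rho>)"
    by (simp add: dist_commute abs_if)
  also have "\<dots> \<le> dist z z' / (2 * \<rho>) * (24 ^ d * \<omega> \<rho>)"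
    using growth[of 24 \<rho>] assms by (intro mult_left_mono) auto
  also have "\<dots> \<le> dist z z' / \<rho> * (24 ^ d * \<omega> \<rho>)"
    using assms pos[of \<rho>] by (intro mult_right_mono) (auto simp: field_simps)
  finally show ?thesis by (simp add: field_simps)
qed

lemma ext_cont: "continuous_on UNIV (ext f X)"
  unfolding continuous_on_iff
proof safe
  fix z :: 'a and e :: real assume e: "0 < e"
  define \<rho> where "\<rho> = infdist z X + 1"
  define L where "L = 24 ^ d * (\<omega> \<rho> / \<rho>)"
  have \<rho>: "0 < \<rho>" "infdist z X \<le> \<rho>" unfolding \<rho>_def using infdist_nonneg[of z X] by auto
  then have L: "L > 0" unfolding L_def using pos by auto
  show "\<exists>\<delta>>0. \<forall>z'\<in>UNIV. dist z' z < \<delta> \<longrightarrow> dist (ext f X z') (ext f X z) < e"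
  proof (intro exI[of _ "min \<rho> (e / L)"] conjI ballI impI)
    fix z' assume z': "dist z' z < min \<rho> (e / L)"
    then have "dist (ext f X z') (ext f X z) \<le> dist z z' * L"
      using ext_lipschitz[of z \<rho> z'] \<rho> unfolding L_def by (simp add: dist_commute dist_real_def)
    also have "\<dots> < e" using z' L by (simp add: field_simps dist_commute)
    finally show "dist (ext f X z') (ext f X z) < e" .
  qed (use \<rho> L e in auto)
qed

end

section \<open>Isoperimetry by translations\<close>

lemma emeasure_translate:
  fixes S :: "'a::euclidean_space set"
  assumes [measurable]: "S \<in> sets borel"
  shows "emeasure lborel {z. z + u \<in> S} = emeasure lborel S"
proof -
  have "emeasure lborel S = emeasure (distr lborel borel ((+) u)) S"
    by (simp add: lborel_distr_plus)
  also have "\<dots> = emeasure lborel {z. z + u \<in> S}"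
    by (subst emeasure_distr) (auto intro!: arg_cong[where f = "emeasure lborel"] simp: add.commute)
  finally show ?thesis by simp
qed

text \<open>
  For a short vector \<open>u\<close> the measure of \<open>escape S u\<close> is of the order of the length of \<open>u\<close> times the
  perimeter of \<open>S\<close> as seen in the direction \<open>u\<close>. In this form the perimeter makes sense for every Borel set.
\<close>
definition escape :: "'a::euclidean_space set \<Rightarrow> 'a \<Rightarrow> 'a set" where
  "escape S u = {z \<in> S. z + u \<notin> S}"

lemma escape_sets [measurable]:
  assumes [measurable]: "S \<in> sets borel"
  shows "escape S u \<in> sets borel"
  unfolding escape_def by measurable

lemma emeasure_escape:
  assumes "S \<in> sets borel"
  shows "emeasure lborel (escape S u) =
    (\<integral>\<^sup>+z. indicator S z * indicator (- S) (z + u) \<partial>lborel)"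
proof -
  have "emeasure lborel (escape S u) = (\<integral>\<^sup>+z. indicator (escape S u) z \<partial>lborel)"
    using assms by simp
  also have "\<dots> = (\<integral>\<^sup>+z. indicator S z * indicator (- S) (z + u) \<partial>lborel)"
    by (intro nn_integral_cong) (auto simp: escape_def indicator_def)
  finally show ?thesis .
qed

text \<open>
  A point that has left \<open>S\<close> after two steps left it either at the first step or at the second one.
\<close>
lemma emeasure_escape_add:
  assumes [measurable]: "S \<in> sets borel"
  shows "emeasure lborel (escape S (u + v)) \<le> emeasure lborel (escape S u) + emeasure lborel (escape S v)"
proof -
  have "emeasure lborel (escape S (u + v)) \<le> emeasure lborel (escape S u \<union> {z. z + u \<in> escape S v})"
    by (intro emeasure_mono) (auto simp: escape_def add.assoc)
  also have "\<dots> \<le> emeasure lborel (escape S u) + emeasure lborel {z. z + u \<in> escape S v}"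
    by (intro emeasure_subadditive) auto
  finally show ?thesis by (simp add: emeasure_translate)
qed

lemma emeasure_escape_scale:
  assumes [measurable]: "S \<in> sets borel"
  shows "emeasure lborel (escape S (real N *\<^sub>R u)) \<le> of_nat N * emeasure lborel (escape S u)"
proof (induction N)
  case (Suc N)
  have "emeasure lborel (escape S (real (Suc N) *\<^sub>R u)) \<le>
    emeasure lborel (escape S u) + emeasure lborel (escape S (real N *\<^sub>R u))"
    using emeasure_escape_add[OF assms, of u "real N *\<^sub>R u"] by (simp add: algebra_simps)
  with Suc show ?case by (simp add: algebra_simps) (meson add_left_mono order_trans)
qed (simp add: escape_def)

lemma emeasure_dilation:
  fixes S :: "'a::euclidean_space set"
  assumes [measurable]: "S \<in> sets borel" and N: "N > 0"
  shows "ennreal (real N ^ DIM('a)) * emeasure lborel {u. z + real N *\<^sub>R u \<in> S} = emeasure lborel S"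
proof -
  have *: "(\<lambda>x. real N *\<^sub>R x + z) ` {u. z + real N *\<^sub>R u \<in> S} = S"
  proof safe
    fix x assume "x \<in> S"
    then show "x \<in> (\<lambda>x. real N *\<^sub>R x + z) ` {u. z + real N *\<^sub>R u \<in> S}"
      using N by (intro image_eqI[of _ _ "(1 / real N) *\<^sub>R (x - z)"]) auto
  qed (simp add: add.commute)
  have "emeasure lebesgue ((\<lambda>x. real N *\<^sub>R x + z) ` {u. z + real N *\<^sub>R u \<in> S}) =
    ennreal (real N ^ DIM('a)) * emeasure lebesgue {u. z + real N *\<^sub>R u \<in> S}"
    by (subst emeasure_lebesgue_affine) simp
  then show ?thesis unfolding * by simp
qed

text \<open>
  The pairs \<open>(z, z + N u)\<close> with both ends in \<open>S\<close> have measure at most \<open>|S|^2 / N^d\<close>. For large \<open>N\<close> this is at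
  most half of the measure of all pairs with \<open>z\<close> in \<open>S\<close> and \<open>u\<close> in the ball.
\<close>
lemma integral_escape_dilated:
  fixes S :: "'a::euclidean_space set"
  assumes [measurable]: "S \<in> sets borel" and fin: "emeasure lborel S < \<infinity>"
    and N: "N > 0" "2 * emeasure lborel S \<le> ennreal (real N ^ DIM('a)) * emeasure lborel (cball (0::'a) r)"
  shows "emeasure lborel (cball (0::'a) r) * emeasure lborel S
    \<le> 2 * (\<integral>\<^sup>+u\<in>cball 0 r. emeasure lborel (escape S (real N *\<^sub>R u)) \<partial>lborel)"
proof -
  define s where "s = emeasure lborel S"
  define B where "B = emeasure lborel (cball (0::'a) r)"
  define stay where "stay u = {z \<in> S. z + real N *\<^sub>R u \<in> S}" for u
  have B: "B < \<infinity>" unfolding B_def by (rule emeasure_lborel_cball_finite)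
  have [measurable]: "stay u \<in> sets borel" for u unfolding stay_def by measurable
  note ind = emeasure_escape[OF assms(1)]
  have ind': "emeasure lborel (stay u) = (\<integral>\<^sup>+z. indicator S z * indicator S (z + real N *\<^sub>R u) \<partial>lborel)" for u
  proof -
    have "emeasure lborel (stay u) = (\<integral>\<^sup>+z. indicator (stay u) z \<partial>lborel)" by simp
    also have "\<dots> = (\<integral>\<^sup>+z. indicator S z * indicator S (z + real N *\<^sub>R u) \<partial>lborel)"
      by (intro nn_integral_cong) (auto simp: stay_def indicator_def)
    finally show ?thesis .
  qed
  have split: "s = emeasure lborel (escape S (real N *\<^sub>R u)) + emeasure lborel (stay u)" for u
    unfolding s_def
    by (subst plus_emeasure) (auto simp: escape_def stay_def intro!: arg_cong[where f = "emeasure lborel"])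
  define K where "K = cball (0::'a) r"
  have [measurable]: "K \<in> sets borel" unfolding K_def by simp
  have "(\<integral>\<^sup>+u\<in>K. emeasure lborel (stay u) \<partial>lborel) =
    (\<integral>\<^sup>+u. \<integral>\<^sup>+z. indicator (K) u * (indicator S z * indicator S (z + real N *\<^sub>R u)) \<partial>lborel \<partial>lborel)"
    unfolding ind' by (subst nn_integral_cmult) (auto simp: mult.commute)
  also have "\<dots> = (\<integral>\<^sup>+z. \<integral>\<^sup>+u. indicator (K) u * (indicator S z * indicator S (z + real N *\<^sub>R u)) \<partial>lborel \<partial>lborel)"
    by (rule lborel_pair.Fubini') measurable
  also have "\<dots> \<le> (\<integral>\<^sup>+z. indicator S z * (\<integral>\<^sup>+u. indicator {u. z + real N *\<^sub>R u \<in> S} u \<partial>lborel) \<partial>lborel)"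
    by (subst nn_integral_cmult[symmetric])
       (auto intro!: nn_integral_mono simp: indicator_def)
  also have "\<dots> = (\<integral>\<^sup>+z. indicator S z * emeasure lborel {u. z + real N *\<^sub>R u \<in> S} \<partial>lborel)"
    by (subst nn_integral_indicator) auto
  finally have stay_le: "(\<integral>\<^sup>+u\<in>K. emeasure lborel (stay u) \<partial>lborel)
    \<le> (\<integral>\<^sup>+z. indicator S z * emeasure lborel {u. z + real N *\<^sub>R u \<in> S} \<partial>lborel)" .
  have half: "2 * emeasure lborel {u. z + real N *\<^sub>R u \<in> S} \<le> B" for z
  proof -
    have "ennreal (real N ^ DIM('a)) * (2 * emeasure lborel {u. z + real N *\<^sub>R u \<in> S}) \<le> ennreal (real N ^ DIM('a)) * B"
      using N(2) unfolding emeasure_dilation[OF assms(1) N(1), of z, symmetric] B_def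
      by (simp add: mult.left_commute)
    then show ?thesis
      by (subst (asm) ennreal_mult_le_mult_iff) (use N(1) in auto)
  qed
  have "2 * (\<integral>\<^sup>+u\<in>K. emeasure lborel (stay u) \<partial>lborel)
    \<le> 2 * (\<integral>\<^sup>+z. indicator S z * emeasure lborel {u. z + real N *\<^sub>R u \<in> S} \<partial>lborel)"
    by (intro mult_left_mono stay_le) simp
  also have "\<dots> = (\<integral>\<^sup>+z. indicator S z * (2 * emeasure lborel {u. z + real N *\<^sub>R u \<in> S}) \<partial>lborel)"
    by (subst nn_integral_cmult[symmetric]) (auto simp: mult_ac)
  also have "\<dots> \<le> (\<integral>\<^sup>+z. indicator S z * B \<partial>lborel)"
    by (intro nn_integral_mono mult_left_mono half) auto
  also have "\<dots> = B * s" unfolding s_def by (subst nn_integral_multc) (auto simp: mult.commute)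
  finally have stay_half: "2 * (\<integral>\<^sup>+u\<in>K. emeasure lborel (stay u) \<partial>lborel) \<le> B * s" .
  have "B * s = (\<integral>\<^sup>+u\<in>K. s \<partial>lborel)"
    unfolding B_def K_def[symmetric] by (simp add: nn_integral_cmult_indicator mult.commute)
  also have "\<dots> = (\<integral>\<^sup>+u\<in>K. emeasure lborel (escape S (real N *\<^sub>R u)) \<partial>lborel)
      + (\<integral>\<^sup>+u\<in>K. emeasure lborel (stay u) \<partial>lborel)"
    apply (subst nn_integral_add[symmetric])
    subgoal unfolding ind by measurable
    subgoal unfolding ind' by measurable
    by (intro nn_integral_cong) (simp add: split[symmetric] distrib_right[symmetric])
  finally have "2 * (B * s) = 2 * (\<integral>\<^sup>+u\<in>K. emeasure lborel (escape S (real N *\<^sub>R u)) \<partial>lborel)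
      + 2 * (\<integral>\<^sup>+u\<in>K. emeasure lborel (stay u) \<partial>lborel)" by (simp add: distrib_left)
  also have "\<dots> \<le> 2 * (\<integral>\<^sup>+u\<in>K. emeasure lborel (escape S (real N *\<^sub>R u)) \<partial>lborel) + B * s"
    by (intro add_left_mono stay_half)
  finally have "B * s + B * s \<le> B * s + 2 * (\<integral>\<^sup>+u\<in>K. emeasure lborel (escape S (real N *\<^sub>R u)) \<partial>lborel)"
    by (simp add: mult_2 add.commute)
  moreover have "B * s < \<infinity>" using B fin unfolding s_def by (simp add: ennreal_mult_less_top)
  ultimately show ?thesis unfolding B_def s_def K_def by (auto simp: ennreal_add_left_cancel_le)
qed

text \<open>
  An isoperimetric inequality. A translation by \<open>N u\<close> with \<open>N\<close> of order \<open>(s / B)^(1/d)\<close> moves half of \<open>S\<close> out of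
  \<open>S\<close> on average, and it consists of \<open>N\<close> translations by \<open>u\<close>, so one of these moves the fraction \<open>1 / (2 * N)\<close>.
\<close>
lemma integral_escape_ge:
  fixes S :: "'a::euclidean_space set"
  assumes [measurable]: "S \<in> sets borel" and fin: "emeasure lborel S < \<infinity>" and r: "0 < r"
  defines "s \<equiv> measure lborel S" and "B \<equiv> measure lborel (cball (0::'a) r)"
  shows "ennreal (B * s / (2 * (root DIM('a) (2 * s / B) + 1)))
    \<le> (\<integral>\<^sup>+u\<in>cball 0 r. emeasure lborel (escape S u) \<partial>lborel)"
proof (cases "s = 0")
  case False
  define I where "I = (\<integral>\<^sup>+u\<in>cball 0 r. emeasure lborel (escape S u) \<partial>lborel)"
  have s: "0 < s" using False unfolding s_def by (simp add: zero_less_measure_iff)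
  have B: "0 < B" unfolding B_def using content_cball_pos[OF r, of 0] by simp
  have eS: "emeasure lborel S = ennreal s" unfolding s_def using fin by (simp add: emeasure_eq_ennreal_measure)
  have eB: "emeasure lborel (cball (0::'a) r) = ennreal B"
    unfolding B_def using emeasure_lborel_cball_finite[of "0::'a" r]
    by (simp add: emeasure_eq_ennreal_measure less_top)
  define x where "x = root DIM('a) (2 * s / B)"
  have x: "x > 0" "x ^ DIM('a) = 2 * s / B" unfolding x_def using s B by auto
  define N where "N = nat \<lceil>x\<rceil>"
  have N: "0 < N" "x \<le> N" "N \<le> x + 1" unfolding N_def using x(1) by linarith+
  have "2 * s / B \<le> real N ^ DIM('a)" unfolding x(2)[symmetric] using N x by (intro power_mono) auto
  then have "2 * emeasure lborel S \<le> ennreal (real N ^ DIM('a)) * emeasure lborel (cball (0::'a) r)"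
    unfolding eS eB using B s
    by (auto simp: ennreal_mult''[symmetric] ennreal_numeral[symmetric] field_simps
        simp del: ennreal_numeral intro!: ennreal_leI)
  from integral_escape_dilated[OF assms(1) fin N(1) this]
  have "ennreal (B * s) \<le> 2 * (\<integral>\<^sup>+u\<in>cball 0 r. emeasure lborel (escape S (real N *\<^sub>R u)) \<partial>lborel)"
    unfolding eS eB using B s by (simp add: ennreal_mult'')
  also have "\<dots> \<le> 2 * (\<integral>\<^sup>+u\<in>cball 0 r. of_nat N * emeasure lborel (escape S u) \<partial>lborel)"
    by (intro mult_left_mono nn_integral_mono mult_right_mono emeasure_escape_scale) auto
  also have "\<dots> = ennreal (2 * N) * I"
  proof -
    have [measurable]: "(\<lambda>u. emeasure lborel (escape S u)) \<in> borel_measurable borel"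
      by (simp add: emeasure_escape)
    have "(\<integral>\<^sup>+u\<in>cball 0 r. of_nat N * emeasure lborel (escape S u) \<partial>lborel) = of_nat N * I"
      unfolding I_def by (subst nn_integral_cmult[symmetric]) (auto intro!: borel_measurable_times_ennreal borel_measurable_indicator simp: mult.assoc)
    then show ?thesis by (simp add: ennreal_mult'' ennreal_of_nat_eq_real_of_nat mult.assoc)
  qed
  finally have "ennreal (B * s) \<le> ennreal (2 * N) * I" .
  then have "ennreal (1 / (2 * N)) * ennreal (B * s) \<le> ennreal (1 / (2 * N)) * (ennreal (2 * N) * I)"
    by (intro mult_left_mono) auto
  also have "\<dots> = I" using N(1) by (simp add: mult.assoc[symmetric] ennreal_mult''[symmetric])
  also have "ennreal (1 / (2 * N)) * ennreal (B * s) = ennreal (B * s / (2 * N))"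
    using B s by (subst ennreal_mult''[symmetric]) auto
  finally have "ennreal (B * s / (2 * N)) \<le> I" .
  moreover have "B * s / (2 * (x + 1)) \<le> B * s / (2 * N)"
    using N B s x by (intro divide_left_mono) auto
  ultimately show ?thesis unfolding I_def x_def by (meson ennreal_leI order_trans)
qed simp

section \<open>Neighbourhoods of compact sets\<close>

definition nbhd :: "'a::euclidean_space set \<Rightarrow> real \<Rightarrow> 'a set" where
  "nbhd X r = {z. infdist z X \<le> r}"

lemma nbhd_mono: "r \<le> s \<Longrightarrow> nbhd X r \<subseteq> nbhd X s"
  by (auto simp: nbhd_def)

lemma mem_nbhd: "x \<in> X \<Longrightarrow> dist z x \<le> r \<Longrightarrow> z \<in> nbhd X r"
  unfolding nbhd_def using infdist_le[of x X z] by auto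

lemma nbhdE:
  assumes "compact X" "X \<noteq> {}" "z \<in> nbhd X r"
  obtains x where "x \<in> X" "dist z x \<le> r"
proof -
  obtain x where "x \<in> X" "infdist z X = dist z x"
    using infdist_attains_inf[of X z] assms compact_imp_closed by blast
  with assms(3) show ?thesis by (intro that[of x]) (auto simp: nbhd_def)
qed

lemma nbhd_add:
  assumes "z \<in> nbhd X r" "norm u \<le> s"
  shows "z + u \<in> nbhd X (r + s)"
  using infdist_triangle[of "z + u" X z] assms by (auto simp: nbhd_def dist_norm)

lemma compact_nbhd:
  assumes "compact X" "X \<noteq> {}"
  shows "compact (nbhd X r)"
proof -
  have "closed (nbhd X r)"
    unfolding nbhd_def by (intro closed_Collect_le continuous_intros)
  moreover obtain R where R: "\<And>x. x \<in> X \<Longrightarrow> norm x \<le> R"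
    using compact_imp_bounded[OF assms(1)] by (auto simp: bounded_iff)
  have "norm z \<le> R + r" if z: "z \<in> nbhd X r" for z
  proof -
    obtain x where "x \<in> X" "dist z x \<le> r" by (rule nbhdE[OF assms z])
    then show ?thesis using R[of x] norm_triangle_sub[of z x] by (simp add: dist_norm)
  qed
  then have "bounded (nbhd X r)" by (auto simp: bounded_iff)
  ultimately show ?thesis by (simp add: compact_eq_bounded_closed)
qed

lemma emeasure_compact:
  assumes "compact (S::'a::euclidean_space set)"
  shows "emeasure lborel S = ennreal (measure lborel S)"
  using emeasure_compact_finite[OF assms] by (simp add: emeasure_eq_ennreal_measure less_top)

lemma emeasure_cball_centre:
  "emeasure lborel (cball (x::'a::euclidean_space) r) = emeasure lborel (cball (0::'a) r)"
proof -
  have "{z. z + x \<in> cball x r} = cball 0 r" by (auto simp: dist_norm)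
  then show ?thesis using emeasure_translate[of "cball x r" x] by (simp del: mem_cball)
qed

context modulus_function
begin

lemma compact_image: "compact (f ` X)"
  by (rule compact_continuous_image[OF f_cont X(1)])

text \<open>
  The values of \<open>f\<close> at the points of \<open>X\<close> within distance \<open>r\<close> of a given point lie in an interval of length
  \<open>2 * \<omega> (2 * r)\<close>, while every value is taken near all points of some ball of radius \<open>r\<close>. Both facts estimate
  the measure of the set \<open>W\<close> of all pairs of a point and a value taken near it.
\<close>
lemma measure_nbhd_ge:
  assumes r: "0 \<le> r"
  shows "measure lborel (f ` X) * measure lborel (cball (0::'a) r)
    \<le> 2 * \<omega> (2 * r) * measure lborel (nbhd X r)"
proof -
  define W where "W = (\<lambda>(x, v). (x + v, f x)) ` (X \<times> cball 0 r)"
  have "compact W"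
    unfolding W_def case_prod_unfold
    by (intro compact_continuous_image compact_Times X continuous_intros compact_cball
        continuous_on_compose2[OF f_cont]) auto
  then have "W \<in> sets borel" by (intro borel_closed compact_imp_closed)
  then have W [measurable]: "W \<in> sets (borel \<Otimes>\<^sub>M borel)" unfolding borel_prod .
  have N: "nbhd X r \<in> sets borel"
    by (intro borel_closed compact_imp_closed compact_nbhd X)
  have "emeasure lborel (f ` X) * emeasure lborel (cball (0::'a) r)
    = (\<integral>\<^sup>+t. emeasure lborel (cball (0::'a) r) * indicator (f ` X) t \<partial>lborel)"
    using borel_closed[OF compact_imp_closed[OF compact_image]]
    by (subst nn_integral_cmult_indicator) (auto simp: mult.commute)
  also have "\<dots> \<le> (\<integral>\<^sup>+t. \<integral>\<^sup>+z. indicator W (z, t) \<partial>lborel \<partial>lborel)"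
  proof (intro nn_integral_mono)
    fix t
    show "emeasure lborel (cball (0::'a) r) * indicator (f ` X) t \<le> (\<integral>\<^sup>+z. indicator W (z, t) \<partial>lborel)"
    proof (cases "t \<in> f ` X")
      case True
      then obtain x where x: "x \<in> X" "t = f x" by auto
      have "emeasure lborel (cball (0::'a) r) = (\<integral>\<^sup>+z. indicator (cball x r) z \<partial>lborel)"
        using emeasure_cball_centre[of x r] by simp
      also have "\<dots> \<le> (\<integral>\<^sup>+z. indicator W (z, t) \<partial>lborel)"
      proof (intro nn_integral_mono)
        fix z
        have "(z, t) \<in> W" if "z \<in> cball x r"
          unfolding W_def using x that
          by (intro image_eqI[of _ _ "(x, z - x)"]) (auto simp: dist_norm norm_minus_commute)
        then show "indicator (cball x r) z \<le> (indicator W (z, t) :: ennreal)"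
          by (auto simp: indicator_def)
      qed
      finally show ?thesis using True by simp
    qed simp
  qed
  also have "\<dots> = (\<integral>\<^sup>+z. \<integral>\<^sup>+t. indicator W (z, t) \<partial>lborel \<partial>lborel)"
    by (rule lborel_pair.Fubini'[symmetric]) simp
  also have "\<dots> \<le> (\<integral>\<^sup>+z. ennreal (2 * \<omega> (2 * r)) * indicator (nbhd X r) z \<partial>lborel)"
  proof (intro nn_integral_mono)
    fix z
    show "(\<integral>\<^sup>+t. indicator W (z, t) \<partial>lborel) \<le> ennreal (2 * \<omega> (2 * r)) * indicator (nbhd X r) z"
    proof (cases "z \<in> nbhd X r")
      case True
      then obtain y where y: "y \<in> X" "dist z y \<le> r" by (rule nbhdE[OF X])
      have "(\<integral>\<^sup>+t. indicator W (z, t) \<partial>lborel) \<le> (\<integral>\<^sup>+t. indicator {f y - \<omega> (2 * r)..f y + \<omega> (2 * r)} t \<partial>lborel)"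
      proof (intro nn_integral_mono)
        fix t
        have "t \<in> {f y - \<omega> (2 * r)..f y + \<omega> (2 * r)}" if zt: "(z, t) \<in> W"
        proof -
          obtain x where x: "x \<in> X" "t = f x" "dist z x \<le> r"
            using zt unfolding W_def by (auto simp: dist_norm)
          then have "dist x y \<le> 2 * r"
            using dist_triangle[of x y z] y by (simp add: dist_commute)
          then have "\<bar>f x - f y\<bar> \<le> \<omega> (2 * r)" by (intro f_le' x y)
          with x show ?thesis by auto
        qed
        then show "indicator W (z, t) \<le> (indicator {f y - \<omega> (2 * r)..f y + \<omega> (2 * r)} t :: ennreal)"
          by (auto simp: indicator_def)
      qed
      also have "\<dots> = ennreal (2 * \<omega> (2 * r))" using nonneg[of "2 * r"] r by simp
      finally show ?thesis using True by simp
    next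
      case False
      have "(z, t) \<notin> W" for t
      proof
        assume "(z, t) \<in> W"
        then obtain x where "x \<in> X" "dist z x \<le> r" unfolding W_def by (auto simp: dist_norm)
        with False show False using mem_nbhd by blast
      qed
      then show ?thesis by simp
    qed
  qed
  also have "\<dots> = ennreal (2 * \<omega> (2 * r)) * emeasure lborel (nbhd X r)"
    using N by (subst nn_integral_cmult_indicator) auto
  finally show ?thesis
    using nonneg[of "2 * r"] r
    by (simp add: emeasure_compact compact_image compact_nbhd X ennreal_mult''[symmetric])
qed

end

section \<open>Cutting a neighbourhood along level sets\<close>

text \<open>
  The lower bound for the perimeter in \<open>integral_escape_ge\<close> is increasing in the volume.
\<close>
lemma divide_root_mono:
  assumes "0 < n" "0 \<le> t" "t \<le> s" "0 \<le> c"
  shows "t / (root n (c * t) + 1) \<le> s / (root n (c * s) + 1)"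
proof (cases "c = 0 \<or> t = 0")
  case True
  then show ?thesis using assms by auto
next
  case False
  then have c: "0 < c" "0 < t" "0 < s" using assms by auto
  define x y where "x = root n (c * t)" and "y = root n (c * s)"
  have xy: "0 < x" "x \<le> y" unfolding x_def y_def using assms c by auto
  have eq: "t = x ^ n / c" "s = y ^ n / c" unfolding x_def y_def using assms c by auto
  have "x ^ (n - 1) \<le> y ^ (n - 1)" using xy by (intro power_mono) auto
  then have "x * y * x ^ (n - 1) \<le> x * y * y ^ (n - 1)" using xy by (intro mult_left_mono) auto
  then have "x ^ n * y \<le> y ^ n * x"
    using assms(1) by (cases n) (auto simp: mult_ac)
  moreover have "x ^ n \<le> y ^ n" using xy by (intro power_mono) auto
  ultimately have "x ^ n * (y + 1) \<le> y ^ n * (x + 1)" by (simp add: distrib_left)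
  then have "x ^ n / (x + 1) \<le> y ^ n / (y + 1)"
    using xy by (simp add: divide_le_eq le_divide_eq mult.commute)
  then have "x ^ n / (x + 1) / c \<le> y ^ n / (y + 1) / c" using c by (intro divide_right_mono) auto
  then show ?thesis
    unfolding x_def[symmetric] y_def[symmetric] unfolding eq by (simp add: mult.commute)
qed

lemma nn_integral_translate:
  fixes h :: "'a::euclidean_space \<Rightarrow> ennreal"
  assumes [measurable]: "h \<in> borel_measurable borel"
  shows "(\<integral>\<^sup>+z. h (z + v) \<partial>lborel) = (\<integral>\<^sup>+z. h z \<partial>lborel)"
proof -
  have "(\<integral>\<^sup>+z. h z \<partial>lborel) = (\<integral>\<^sup>+z. h z \<partial>distr lborel borel ((+) v))"
    by (simp add: lborel_distr_plus)
  also have "\<dots> = (\<integral>\<^sup>+z. h (v + z) \<partial>lborel)"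
    by (subst nn_integral_distr) auto
  finally show ?thesis by (simp add: add.commute)
qed

lemma emeasure_window:
  fixes T :: "real set"
  assumes "T \<in> sets borel"
  shows "emeasure lborel (T \<inter> {a + g..a + 3 * g})
    = (\<integral>\<^sup>+t. (if t \<in> T \<and> a + g \<le> t \<and> t \<le> a + 3 * g then 1 else 0) \<partial>lborel)"
proof -
  have "emeasure lborel (T \<inter> {a + g..a + 3 * g}) = (\<integral>\<^sup>+t. indicator (T \<inter> {a + g..a + 3 * g}) t \<partial>lborel)"
    using assms by simp
  also have "\<dots> = (\<integral>\<^sup>+t. (if t \<in> T \<and> a + g \<le> t \<and> t \<le> a + 3 * g then 1 else 0) \<partial>lborel)"
    by (intro nn_integral_cong) (auto simp: indicator_def)
  finally show ?thesis .
qed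

lemma nn_integral_sliding_window:
  fixes T :: "real set"
  assumes [measurable]: "T \<in> sets borel" and g: "0 \<le> g"
  shows "(\<integral>\<^sup>+a. emeasure lborel (T \<inter> {a + g..a + 3 * g}) \<partial>lborel) = ennreal (2 * g) * emeasure lborel T"
proof -
  have "(\<integral>\<^sup>+a. emeasure lborel (T \<inter> {a + g..a + 3 * g}) \<partial>lborel)
    = (\<integral>\<^sup>+a. \<integral>\<^sup>+t. (if t \<in> T \<and> a + g \<le> t \<and> t \<le> a + 3 * g then 1 else 0) \<partial>lborel \<partial>lborel)"
    by (intro nn_integral_cong emeasure_window) simp
  also have "\<dots> = (\<integral>\<^sup>+t. \<integral>\<^sup>+a. (if t \<in> T \<and> a + g \<le> t \<and> t \<le> a + 3 * g then 1 else 0) \<partial>lborel \<partial>lborel)"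
    by (rule lborel_pair.Fubini'[symmetric]) measurable
  also have "\<dots> = (\<integral>\<^sup>+t. ennreal (2 * g) * indicator T t \<partial>lborel)"
  proof (intro nn_integral_cong)
    fix t
    have "(\<integral>\<^sup>+a. (if t \<in> T \<and> a + g \<le> t \<and> t \<le> a + 3 * g then 1 else 0) \<partial>lborel)
      = (\<integral>\<^sup>+a. indicator T t * indicator {t - 3 * g..t - g} a \<partial>lborel)"
      by (intro nn_integral_cong) (auto simp: indicator_def)
    also have "\<dots> = ennreal (2 * g) * indicator T t"
      using g by (subst nn_integral_cmult) (auto simp: mult.commute)
    finally show "(\<integral>\<^sup>+a. (if t \<in> T \<and> a + g \<le> t \<and> t \<le> a + 3 * g then 1 else 0) \<partial>lborel) = \<dots>" .
  qed
  also have "\<dots> = ennreal (2 * g) * emeasure lborel T"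
    by (subst nn_integral_cmult_indicator) auto
  finally show ?thesis .
qed

context modulus_function
begin

text \<open>
  The part of the neighbourhood between two level sets of the extension. Within the neighbourhood the extension
  differs from the nearby values of \<open>f\<close> by at most \<open>\<omega> (4 * r)\<close>, so a window four times as long retains all
  points near the part of \<open>X\<close> whose values lie in its middle half.
\<close>
definition slice :: "real \<Rightarrow> real \<Rightarrow> 'a set" where
  "slice r a = {z \<in> nbhd X r. a \<le> ext f X z \<and> ext f X z \<le> a + 4 * \<omega> (4 * r)}"

lemma ext_measurable [measurable]: "ext f X \<in> borel_measurable borel"
  by (rule borel_measurable_continuous_onI[OF ext_cont])

lemma nbhd_sets [measurable]: "nbhd X r \<in> sets borel"
  by (intro borel_closed compact_imp_closed compact_nbhd X)

lemma slice_sets [measurable]: "slice r a \<in> sets borel"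
  unfolding slice_def by measurable

lemma compact_slice: "compact (slice r a)"
proof -
  have "closed {z. a \<le> ext f X z \<and> ext f X z \<le> a + 4 * \<omega> (4 * r)}"
    by (intro closed_Collect_conj closed_Collect_le continuous_intros ext_cont)
  moreover have "slice r a = nbhd X r \<inter> {z. a \<le> ext f X z \<and> ext f X z \<le> a + 4 * \<omega> (4 * r)}"
    by (auto simp: slice_def)
  ultimately show ?thesis using compact_nbhd[OF X] by (metis compact_Int_closed)
qed

lemma measure_slice_ge:
  assumes "0 \<le> b" and b: "\<And>Y. compact Y \<Longrightarrow> Y \<noteq> {} \<Longrightarrow> Y \<subseteq> X \<Longrightarrow>
    b * measure lborel (f ` Y) \<le> measure lborel (nbhd Y r)"
  shows "b * measure lborel (f ` X \<inter> {a + \<omega> (4 * r)..a + 3 * \<omega> (4 * r)}) \<le> measure lborel (slice r a)"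
proof -
  define Y where "Y = X \<inter> f -` {a + \<omega> (4 * r)..a + 3 * \<omega> (4 * r)}"
  have fY: "f ` X \<inter> {a + \<omega> (4 * r)..a + 3 * \<omega> (4 * r)} = f ` Y" unfolding Y_def by auto
  show ?thesis
  proof (cases "Y = {}")
    case True
    then show ?thesis unfolding fY by simp
  next
    case False
    have "closed Y"
      unfolding Y_def by (intro continuous_closed_preimage f_cont compact_imp_closed X) auto
    then have "compact Y"
      using X(1) unfolding Y_def by (metis Int_absorb1 compact_Int_closed inf_le1)
    have "nbhd Y r \<subseteq> slice r a"
    proof
      fix z assume z: "z \<in> nbhd Y r"
      then obtain x where x: "x \<in> Y" "dist z x \<le> r" by (rule nbhdE[OF \<open>compact Y\<close> False])
      then have "x \<in> X" "a + \<omega> (4 * r) \<le> f x" "f x \<le> a + 3 * \<omega> (4 * r)" unfolding Y_def by auto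
      then have "z \<in> nbhd X r" "\<bar>ext f X z - f x\<bar> \<le> \<omega> (4 * r)"
        using x mem_nbhd[of x X z r] ext_near[of x z r] by (auto simp: dist_commute)
      then show "z \<in> slice r a"
        unfolding slice_def using \<open>a + \<omega> (4 * r) \<le> f x\<close> \<open>f x \<le> a + 3 * \<omega> (4 * r)\<close>
        by (auto simp: abs_le_iff)
    qed
    moreover have "emeasure lborel (slice r a) \<noteq> \<infinity>" "nbhd Y r \<in> sets lborel"
      using emeasure_compact[OF compact_slice] compact_nbhd[OF \<open>compact Y\<close> False]
        by (auto intro!: borel_closed compact_imp_closed)
    ultimately have "measure lborel (nbhd Y r) \<le> measure lborel (slice r a)"
      by (intro measure_mono_fmeasurable) (auto simp: fmeasurable_def less_top)
    moreover have "b * measure lborel (f ` Y) \<le> measure lborel (nbhd Y r)"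
      by (rule b[OF \<open>compact Y\<close> False]) (simp add: Y_def)
    ultimately show ?thesis unfolding fY by linarith
  qed
qed

text \<open>
  The isoperimetric inequality for all slices at once. Sliding the window over the line replaces a sum over
  disjoint windows by an integral; each value of \<open>f\<close> is in the middle half of the window for positions \<open>a\<close> of
  total length \<open>l / 2\<close>. No middle half contains values of total length more than \<open>l\<close>, so one denominator
  serves for all slices.
\<close>
lemma integral_escape_slices_ge:
  assumes "0 \<le> b" and b: "\<And>Y. compact Y \<Longrightarrow> Y \<noteq> {} \<Longrightarrow> Y \<subseteq> X \<Longrightarrow>
      b * measure lborel (f ` Y) \<le> measure lborel (nbhd Y r)"
    and r: "0 < r"
  defines "l \<equiv> 4 * \<omega> (4 * r)" and "B \<equiv> measure lborel (cball (0::'a) r)"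
  shows "ennreal (B * l * (b * measure lborel (f ` X) / (4 * (root d (2 * b * l / B) + 1))))
    \<le> (\<integral>\<^sup>+a. (\<integral>\<^sup>+u\<in>cball 0 r. emeasure lborel (escape (slice r a) u) \<partial>lborel) \<partial>lborel)"
proof -
  define g where "g = \<omega> (4 * r)"
  define e where "e a = measure lborel (f ` X \<inter> {a + g..a + 3 * g})" for a
  define D where "D = 2 * (root d (2 * b * l / B) + 1)"
  have g: "0 < g" unfolding g_def using pos[of "4 * r"] r by simp
  have l: "l = 4 * g" unfolding l_def g_def ..
  have B: "0 < B" unfolding B_def using content_cball_pos[OF r, of "0::'a"] by simp
  have d: "0 < d" using d_ge_2 by simp
  have D: "0 < D" unfolding D_def using assms(1) g B d
    by (auto simp: l intro!: add_nonneg_pos real_root_ge_zero)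
  have fX: "f ` X \<in> sets borel" by (intro borel_closed compact_imp_closed compact_image)
  have comp: "compact (f ` X \<inter> {a + g..a + 3 * g})" for a
    using compact_image by (intro compact_Int_closed) auto
  have e0: "0 \<le> e a" for a unfolding e_def by simp
  have el: "e a \<le> l" for a
  proof -
    have "e a \<le> measure lborel {a + g..a + 3 * g}"
      unfolding e_def using g by (intro measure_mono_fmeasurable) (auto simp: fmeasurable_def fX)
    then show ?thesis using g by (simp add: l)
  qed
  have low: "ennreal (B * b / D) * emeasure lborel (f ` X \<inter> {a + g..a + 3 * g})
    \<le> (\<integral>\<^sup>+u\<in>cball 0 r. emeasure lborel (escape (slice r a) u) \<partial>lborel)" for a
  proof -
    define s where "s = measure lborel (slice r a)"
    have s: "b * e a \<le> s" unfolding s_def e_def g_def by (rule measure_slice_ge[OF assms(1) b])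
    have "b * e a / D * 2 \<le> b * e a / (root d (2 / B * (b * e a)) + 1)"
    proof -
      have "2 / B * (b * e a) \<le> 2 * b * l / B"
        using mult_left_mono[OF el[of a] assms(1)] B by (simp add: field_simps)
      then have "root d (2 / B * (b * e a)) + 1 \<le> root d (2 * b * l / B) + 1"
        using d by simp
      moreover have "0 \<le> root d (2 / B * (b * e a))"
        using assms(1) B e0[of a] d by (intro real_root_ge_zero) auto
      ultimately have "b * e a / (root d (2 * b * l / B) + 1) \<le> b * e a / (root d (2 / B * (b * e a)) + 1)"
        using assms(1) e0[of a] by (intro divide_left_mono mult_pos_pos) auto
      moreover have "x / (2 * q) * 2 = x / q" for x q :: real by simp
      ultimately show ?thesis unfolding D_def by (simp only:)
    qed
    also have "\<dots> \<le> s / (root d (2 / B * s) + 1)"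
      using assms(1) B e0[of a] s d by (intro divide_root_mono) auto
    finally have le: "b * e a / D * 2 \<le> s / (root d (2 / B * s) + 1)" .
    have "x \<le> y / 2" if "x * 2 \<le> y" for x y :: real using that by simp
    from this[OF le] have "b * e a / D \<le> s / (2 * (root d (2 / B * s) + 1))"
      by (simp only: divide_divide_eq_left')
    then have "B * (b * e a / D) \<le> B * (s / (2 * (root d (2 / B * s) + 1)))"
      using B by (intro mult_left_mono) auto
    then have "ennreal (B * b / D * e a) \<le> ennreal (B * s / (2 * (root d (2 * s / B) + 1)))"
      by (intro ennreal_leI) simp
    also have "\<dots> \<le> (\<integral>\<^sup>+u\<in>cball 0 r. emeasure lborel (escape (slice r a) u) \<partial>lborel)"
      using integral_escape_ge[OF slice_sets _ r, of r a] emeasure_compact[OF compact_slice, of r a]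
      unfolding s_def B_def dim by simp
    finally show ?thesis
      unfolding emeasure_compact[OF comp] e_def[symmetric]
      using B D assms(1) e0[of a] by (subst ennreal_mult[symmetric]) auto
  qed
  have "ennreal (B * l * (b * measure lborel (f ` X) / (4 * (root d (2 * b * l / B) + 1))))
    = ennreal (B * b / D * (2 * g) * measure lborel (f ` X))"
  proof -
    have "B * (4 * g) * (b * E / (4 * q)) = B * b / (2 * q) * (2 * g) * E" for q E :: real by simp
    then show ?thesis unfolding D_def l by (simp only:)
  qed
  also have "\<dots> = ennreal (B * b / D) * (\<integral>\<^sup>+a. emeasure lborel (f ` X \<inter> {a + g..a + 3 * g}) \<partial>lborel)"
  proof -
    have eq: "ennreal (K * (2 * g) * E) = ennreal K * (ennreal (2 * g) * ennreal E)"
      if "0 \<le> K" "0 \<le> E" for K E :: real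
      using that g by (subst ennreal_mult[symmetric], simp, simp, subst ennreal_mult[symmetric], simp, simp)
        (simp add: mult.assoc)
    show ?thesis
      unfolding nn_integral_sliding_window[OF fX less_imp_le[OF g]] emeasure_compact[OF compact_image]
      by (rule eq) (use B D assms(1) in auto)
  qed
  also have "\<dots> = (\<integral>\<^sup>+a. ennreal (B * b / D) * emeasure lborel (f ` X \<inter> {a + g..a + 3 * g}) \<partial>lborel)"
  proof (rule nn_integral_cmult[symmetric])
    note [measurable] = fX
    have "(\<lambda>a. (\<integral>\<^sup>+t. (if t \<in> f ` X \<and> a + g \<le> t \<and> t \<le> a + 3 * g then 1 else 0 :: ennreal) \<partial>lborel)) \<in> borel_measurable lborel"
      by measurable
    then show "(\<lambda>a. emeasure lborel (f ` X \<inter> {a + g..a + 3 * g})) \<in> borel_measurable lborel"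
      by (simp only: emeasure_window[OF fX])
  qed
  also have "\<dots> \<le> (\<integral>\<^sup>+a. (\<integral>\<^sup>+u\<in>cball 0 r. emeasure lborel (escape (slice r a) u) \<partial>lborel) \<partial>lborel)"
    by (intro nn_integral_mono low)
  finally show ?thesis .
qed

lemma emeasure_escape_slice:
  assumes "l = 4 * \<omega> (4 * r)"
  shows "emeasure lborel (escape (slice r a) u)
    = (\<integral>\<^sup>+z. (if (z \<in> nbhd X r \<and> a \<le> ext f X z \<and> ext f X z \<le> a + l) \<and>
        \<not> (z + u \<in> nbhd X r \<and> a \<le> ext f X (z + u) \<and> ext f X (z + u) \<le> a + l) then 1 else 0) \<partial>lborel)"
proof -
  have "emeasure lborel (escape (slice r a) u) = (\<integral>\<^sup>+z. indicator (escape (slice r a) u) z \<partial>lborel)"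
    by simp
  also have "\<dots> = (\<integral>\<^sup>+z. (if (z \<in> nbhd X r \<and> a \<le> ext f X z \<and> ext f X z \<le> a + l) \<and>
        \<not> (z + u \<in> nbhd X r \<and> a \<le> ext f X (z + u) \<and> ext f X (z + u) \<le> a + l) then 1 else 0) \<partial>lborel)"
    by (intro nn_integral_cong) (auto simp: escape_def slice_def indicator_def assms)
  finally show ?thesis .
qed

text \<open>
  The coarea principle for translations. A step by \<open>u\<close> leaves a slice either together with the whole
  neighbourhood, in which case it ends in the added layer, or because the value of the extension leaves the window; for
  given \<open>z\<close> the latter concerns a set of window positions of length at most the change of the extension.
\<close>
lemma integral_escape_slices_le:
  assumes r: "0 \<le> r" and u: "norm u \<le> r"
  defines "l \<equiv> 4 * \<omega> (4 * r)"
  shows "(\<integral>\<^sup>+a. emeasure lborel (escape (slice r a) u) \<partial>lborel)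
    \<le> ennreal (l * (measure lborel (nbhd X (2 * r)) - measure lborel (nbhd X r)))
      + (\<integral>\<^sup>+z\<in>nbhd X r. ennreal \<bar>ext f X z - ext f X (z + u)\<bar> \<partial>lborel)"
proof -
  let ?F = "ext f X" and ?O = "nbhd X r"
  have l: "0 \<le> l" unfolding l_def using nonneg[of "4 * r"] r by simp
  have "(\<integral>\<^sup>+a. emeasure lborel (escape (slice r a) u) \<partial>lborel)
    = (\<integral>\<^sup>+a. \<integral>\<^sup>+z. (if (z \<in> ?O \<and> a \<le> ?F z \<and> ?F z \<le> a + l) \<and>
        \<not> (z + u \<in> ?O \<and> a \<le> ?F (z + u) \<and> ?F (z + u) \<le> a + l) then 1 else 0) \<partial>lborel \<partial>lborel)"
    by (intro nn_integral_cong emeasure_escape_slice) (simp_all add: l_def)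
  also have "\<dots> = (\<integral>\<^sup>+z. \<integral>\<^sup>+a. (if (z \<in> ?O \<and> a \<le> ?F z \<and> ?F z \<le> a + l) \<and>
        \<not> (z + u \<in> ?O \<and> a \<le> ?F (z + u) \<and> ?F (z + u) \<le> a + l) then 1 else 0) \<partial>lborel \<partial>lborel)"
    by (rule lborel_pair.Fubini'[symmetric]) measurable
  also have "\<dots> \<le> (\<integral>\<^sup>+z. ennreal l * indicator (escape ?O u) z
      + ennreal \<bar>?F z - ?F (z + u)\<bar> * indicator ?O z \<partial>lborel)"
  proof (intro nn_integral_mono)
    fix z
    let ?I = "\<integral>\<^sup>+a. (if (z \<in> ?O \<and> a \<le> ?F z \<and> ?F z \<le> a + l) \<and>
        \<not> (z + u \<in> ?O \<and> a \<le> ?F (z + u) \<and> ?F (z + u) \<le> a + l) then 1 else 0) \<partial>lborel"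
    consider "z \<notin> ?O" | "z \<in> ?O" "z + u \<notin> ?O" | "z \<in> ?O" "z + u \<in> ?O" "?F z \<le> ?F (z + u)"
      | "z \<in> ?O" "z + u \<in> ?O" "?F (z + u) \<le> ?F z" by linarith
    then show "?I \<le> ennreal l * indicator (escape ?O u) z + ennreal \<bar>?F z - ?F (z + u)\<bar> * indicator ?O z"
    proof cases
      case 1
      then show ?thesis by simp
    next
      case 2
      have "?I \<le> (\<integral>\<^sup>+a. indicator {?F z - l..?F z} a \<partial>lborel)"
        by (intro nn_integral_mono) (auto simp: indicator_def)
      also have "\<dots> = ennreal l" using l by simp
      finally show ?thesis using 2 by (simp add: escape_def add_increasing2)
    next
      case 3
      have "?I \<le> (\<integral>\<^sup>+a. indicator {?F z - l..?F (z + u) - l} a \<partial>lborel)"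
        using 3 by (intro nn_integral_mono) (auto simp: indicator_def)
      also have "\<dots> = ennreal \<bar>?F z - ?F (z + u)\<bar>" using 3 by simp
      finally show ?thesis using 3 by (simp add: add_increasing)
    next
      case 4
      have "?I \<le> (\<integral>\<^sup>+a. indicator {?F (z + u)..?F z} a \<partial>lborel)"
        using 4 by (intro nn_integral_mono) (auto simp: indicator_def)
      also have "\<dots> = ennreal \<bar>?F z - ?F (z + u)\<bar>" using 4 by simp
      finally show ?thesis using 4 by (simp add: add_increasing)
    qed
  qed
  also have "\<dots> = ennreal l * emeasure lborel (escape ?O u)
      + (\<integral>\<^sup>+z\<in>?O. ennreal \<bar>?F z - ?F (z + u)\<bar> \<partial>lborel)"
    by (subst nn_integral_add) (auto simp: nn_integral_cmult_indicator)
  finally have main: "(\<integral>\<^sup>+a. emeasure lborel (escape (slice r a) u) \<partial>lborel)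
    \<le> ennreal l * emeasure lborel (escape ?O u) + (\<integral>\<^sup>+z\<in>?O. ennreal \<bar>?F z - ?F (z + u)\<bar> \<partial>lborel)" .
  have "emeasure lborel (escape ?O u)
    \<le> ennreal (measure lborel (nbhd X (2 * r)) - measure lborel ?O)"
  proof -
    have "emeasure lborel (escape ?O u) \<le> emeasure lborel {z. z + u \<in> nbhd X (2 * r) - ?O}"
    proof (intro emeasure_mono subsetI)
      fix z assume z: "z \<in> escape ?O u"
      then have "z + u \<in> nbhd X (2 * r)"
        unfolding mult_2 by (intro nbhd_add u) (simp add: escape_def)
      then show "z \<in> {z. z + u \<in> nbhd X (2 * r) - ?O}"
        using z by (simp add: escape_def)
    qed measurable
    also have "\<dots> = emeasure lborel (nbhd X (2 * r) - ?O)"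
      by (rule emeasure_translate) auto
    also have "\<dots> = emeasure lborel (nbhd X (2 * r)) - emeasure lborel ?O"
      using nbhd_mono[of r "2 * r" X] r emeasure_compact[OF compact_nbhd[OF X], of r]
      by (intro emeasure_Diff) auto
    finally show ?thesis
      by (simp add: emeasure_compact compact_nbhd X ennreal_minus)
  qed
  then have "ennreal l * emeasure lborel (escape ?O u)
    \<le> ennreal l * ennreal (measure lborel (nbhd X (2 * r)) - measure lborel ?O)"
    by (rule mult_left_mono) simp
  then have "ennreal l * emeasure lborel (escape ?O u)
    \<le> ennreal (l * (measure lborel (nbhd X (2 * r)) - measure lborel ?O))"
    using l by (simp add: ennreal_mult')
  with main show ?thesis by (meson add_right_mono order_trans)
qed

text \<open>
  An upper bound for the slope of the extension, up to the factor \<open>24^d\<close>. The cut-off \<open>\<delta>\<close> keeps it finite on \<open>X\<close> and is the length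
  below which increments of the extension are estimated by it.
\<close>
definition steepness :: "real \<Rightarrow> 'a \<Rightarrow> real" where
  "steepness \<delta> z = \<omega> (max (infdist z X) \<delta>) / max (infdist z X) \<delta>"

lemma steepness_measurable [measurable]:
  assumes "0 < \<delta>"
  shows "steepness \<delta> \<in> borel_measurable borel"
proof (rule borel_measurable_continuous_onI)
  show "continuous_on UNIV (steepness \<delta>)"
    unfolding steepness_def using assms
    by (intro continuous_intros continuous_on_compose2[OF cont]) auto
qed

lemma steepness_nonneg: "0 < \<delta> \<Longrightarrow> 0 \<le> steepness \<delta> z"
  unfolding steepness_def using nonneg[of "max (infdist z X) \<delta>"] by auto

lemma ext_step:
  assumes "0 < \<delta>" "norm v \<le> \<delta>"
  shows "\<bar>ext f X z - ext f X (z + v)\<bar> \<le> norm v * (24 ^ d * steepness \<delta> z)"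
  using ext_lipschitz[of z "max (infdist z X) \<delta>" "z + v"] assms
  by (simp add: steepness_def dist_norm)

text \<open>
  A long translation is divided into \<open>N\<close> steps no longer than the cut-off; by translation invariance all steps
  contribute the same integral.
\<close>
lemma integral_ext_diff_le:
  assumes \<delta>: "0 < \<delta>" and r: "0 < r" and u: "norm u \<le> r"
  shows "(\<integral>\<^sup>+z\<in>nbhd X r. ennreal \<bar>ext f X z - ext f X (z + u)\<bar> \<partial>lborel)
    \<le> ennreal (24 ^ d * r) * (\<integral>\<^sup>+z\<in>nbhd X (2 * r). ennreal (steepness \<delta> z) \<partial>lborel)"
proof -
  let ?F = "ext f X" and ?J = "\<integral>\<^sup>+z\<in>nbhd X (2 * r). ennreal (steepness \<delta> z) \<partial>lborel"
  obtain N :: nat where N: "N > 0" "r \<le> real N * \<delta>"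
  proof -
    obtain N :: nat where "r / \<delta> < real N" using reals_Archimedean2 by blast
    then show ?thesis using \<delta> r by (intro that[of N]) (auto simp: field_simps intro: gr0I)
  qed
  note [measurable] = steepness_measurable[OF \<delta>]
  define p where "p i = (real i / real N) *\<^sub>R u" for i :: nat
  define c where "c = 24 ^ d * r / real N"
  have c: "0 \<le> c" unfolding c_def using r by simp
  have step: "\<bar>?F (z + p i) - ?F (z + p (Suc i))\<bar> \<le> c * steepness \<delta> (z + p i)" for z i
  proof -
    define v where "v = (1 / real N) *\<^sub>R u"
    have v: "norm v \<le> r / N" unfolding v_def using u N(1) by (auto simp: divide_right_mono)
    also have "\<dots> \<le> \<delta>" using N by (simp add: field_simps)
    finally have "\<bar>?F (z + p i) - ?F (z + p i + v)\<bar> \<le> norm v * (24 ^ d * steepness \<delta> (z + p i))"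
      by (rule ext_step[OF \<delta>])
    also have "\<dots> \<le> r / N * (24 ^ d * steepness \<delta> (z + p i))"
      using v steepness_nonneg[OF \<delta>] by (intro mult_right_mono) auto
    also have "z + p i + v = z + p (Suc i)"
      unfolding p_def v_def by (simp add: add_divide_distrib algebra_simps)
    finally show ?thesis unfolding c_def by (simp add: field_simps)
  qed
  have chain: "\<bar>?F z - ?F (z + u)\<bar> \<le> (\<Sum>i<N. c * steepness \<delta> (z + p i))" for z
  proof -
    have "\<bar>?F (z + p 0) - ?F (z + p n)\<bar> \<le> (\<Sum>i<n. c * steepness \<delta> (z + p i))" for n
    proof (induction n)
      case (Suc n)
      then show ?case using step[of z n] by simp
    qed simp
    from this[of N] show ?thesis using N(1) by (simp add: p_def)
  qed
  have "(\<integral>\<^sup>+z\<in>nbhd X r. ennreal \<bar>?F z - ?F (z + u)\<bar> \<partial>lborel)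
    \<le> (\<integral>\<^sup>+z. (\<Sum>i<N. ennreal c * (ennreal (steepness \<delta> (z + p i)) * indicator (nbhd X (2 * r)) (z + p i))) \<partial>lborel)"
  proof (intro nn_integral_mono)
    fix z
    show "ennreal \<bar>?F z - ?F (z + u)\<bar> * indicator (nbhd X r) z
      \<le> (\<Sum>i<N. ennreal c * (ennreal (steepness \<delta> (z + p i)) * indicator (nbhd X (2 * r)) (z + p i)))"
    proof (cases "z \<in> nbhd X r")
      case True
      have "z + p i \<in> nbhd X (2 * r)" if "i < N" for i
      proof -
        have "norm (p i) = real i / real N * norm u" by (simp add: p_def)
        also have "\<dots> \<le> 1 * r" using that u N(1) by (intro mult_mono) auto
        finally show ?thesis unfolding mult_2 by (intro nbhd_add True) simp
      qed
      then have "(\<Sum>i<N. ennreal c * (ennreal (steepness \<delta> (z + p i)) * indicator (nbhd X (2 * r)) (z + p i)))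
        = (\<Sum>i<N. ennreal (c * steepness \<delta> (z + p i)))"
        using c steepness_nonneg[OF \<delta>] by (intro sum.cong) (auto simp: ennreal_mult)
      also have "\<dots> = ennreal (\<Sum>i<N. c * steepness \<delta> (z + p i))"
        using c steepness_nonneg[OF \<delta>] by (intro sum_ennreal) auto
      finally show ?thesis using True chain[of z] by (simp add: ennreal_leI)
    qed simp
  qed
  also have "\<dots> = (\<Sum>i<N. ennreal c * (\<integral>\<^sup>+z. ennreal (steepness \<delta> (z + p i)) * indicator (nbhd X (2 * r)) (z + p i) \<partial>lborel))"
    by (subst nn_integral_sum) (auto simp: nn_integral_cmult)
  also have "\<dots> = (\<Sum>i<N. ennreal c * ?J)"
    by (intro sum.cong refl arg_cong[where f = "\<lambda>x. ennreal c * x"]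
        nn_integral_translate[where h = "\<lambda>z. ennreal (steepness \<delta> z) * indicator (nbhd X (2 * r)) z"]) measurable
  also have "\<dots> = ennreal (24 ^ d * r) * ?J"
  proof -
    have "(\<Sum>i<N. ennreal c * ?J) = ennreal (real N * c) * ?J"
      using c by (simp add: ennreal_mult'' ennreal_of_nat_eq_real_of_nat mult.assoc)
    also have "real N * c = 24 ^ d * r" unfolding c_def using N(1) by simp
    finally show ?thesis .
  qed
  finally show ?thesis .
qed

end

section \<open>Growth of the volume from one dyadic scale to the next\<close>

abbreviation dyadic :: "nat \<Rightarrow> real" where
  "dyadic k \<equiv> (1 / 2) ^ k"

context modulus
begin

text \<open>
  These are the sequences \<open>q\<close> and \<open>h\<close> of the introduction.
\<close>
definition quot :: "nat \<Rightarrow> real" where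
  "quot k = dyadic k / \<omega> (dyadic k)"

definition weight :: "nat \<Rightarrow> real" where
  "weight k = dyadic k / root d (\<omega> (dyadic k))"

lemma quot_pos: "0 < quot k"
  unfolding quot_def using pos[of "dyadic k"] by simp

lemma weight_pos: "0 < weight k"
  unfolding weight_def using pos[of "dyadic k"] d_ge_2 by simp

end

context modulus_function
begin

definition vol :: "nat \<Rightarrow> real" where
  "vol k = measure lborel (nbhd X (dyadic k))"

text \<open>
  This bounds the integral of the steepness with cut-off \<open>2^-m\<close> over the neighbourhood of radius \<open>2^-k\<close>: on the
  layer between the radii \<open>2^-(j+1)\<close> and \<open>2^-j\<close> the steepness is at most \<open>1 / quot j\<close>, because \<open>\<omega> r / r\<close> increases.
\<close>
definition tail :: "nat \<Rightarrow> nat \<Rightarrow> real" where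
  "tail m k = (\<Sum>j=k..<m. (vol j - vol (Suc j)) / quot j) + vol m / quot m"

lemma vol_nonneg: "0 \<le> vol k"
  unfolding vol_def by simp

lemma measure_nbhd_mono: "r \<le> s \<Longrightarrow> measure lborel (nbhd X r) \<le> measure lborel (nbhd X s)"
  using emeasure_compact[OF compact_nbhd[OF X]]
  by (intro measure_mono_fmeasurable nbhd_mono) (auto simp: fmeasurable_def)

lemma vol_Suc_le: "vol (Suc k) \<le> vol k"
  unfolding vol_def by (intro measure_nbhd_mono) simp

lemma tail_nonneg: "0 \<le> tail m k"
  unfolding tail_def
  by (intro add_nonneg_nonneg sum_nonneg divide_nonneg_pos vol_nonneg quot_pos) (simp add: vol_Suc_le)

lemma tail_step: "k < m \<Longrightarrow> tail m k = (vol k - vol (Suc k)) / quot k + tail m (Suc k)"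
  unfolding tail_def by (simp add: sum.atLeast_Suc_lessThan)

lemma steepness_le:
  assumes "infdist z X \<le> dyadic k" "k \<le> m"
  shows "steepness (dyadic m) z \<le> 1 / quot k"
proof -
  have "dyadic m \<le> dyadic k" using assms(2) by (intro power_decreasing) auto
  then have "max (infdist z X) (dyadic m) \<le> dyadic k" using assms(1) by simp
  moreover have "0 < dyadic m" by simp
  then have "0 < max (infdist z X) (dyadic m)" by linarith
  ultimately show ?thesis
    unfolding steepness_def quot_def using quotient_mono by simp
qed

lemma integral_steepness_le:
  assumes "k \<le> m"
  shows "(\<integral>\<^sup>+z\<in>nbhd X (dyadic k). ennreal (steepness (dyadic m) z) \<partial>lborel) \<le> ennreal (tail m k)"
  using assms
proof (induction rule: inc_induct)
  case base
  have "(\<integral>\<^sup>+z\<in>nbhd X (dyadic m). ennreal (steepness (dyadic m) z) \<partial>lborel)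
    \<le> (\<integral>\<^sup>+z. ennreal (1 / quot m) * indicator (nbhd X (dyadic m)) z \<partial>lborel)"
    using steepness_le[of _ m m]
    by (intro nn_integral_mono) (auto simp: nbhd_def indicator_def intro!: ennreal_leI)
  also have "\<dots> = ennreal (1 / quot m) * ennreal (vol m)"
    unfolding vol_def emeasure_compact[OF compact_nbhd[OF X], symmetric]
    by (rule nn_integral_cmult_indicator) simp
  also have "\<dots> = ennreal (tail m m)"
    using vol_nonneg quot_pos[of m] by (simp add: tail_def ennreal_mult''[symmetric])
  finally show ?case .
next
  case (step k)
  let ?O = "nbhd X (dyadic k)" and ?P = "nbhd X (dyadic (Suc k))"
  note [measurable] = steepness_measurable[of "dyadic m"]
  have PO: "?P \<subseteq> ?O" by (intro nbhd_mono) simp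
  have fin: "emeasure lborel ?P \<noteq> \<infinity>"
    by (simp add: emeasure_compact compact_nbhd X)
  have "(\<integral>\<^sup>+z\<in>?O. ennreal (steepness (dyadic m) z) \<partial>lborel)
    \<le> (\<integral>\<^sup>+z. ennreal (1 / quot k) * indicator (?O - ?P) z + ennreal (steepness (dyadic m) z) * indicator ?P z \<partial>lborel)"
    using steepness_le[of _ k m] step.hyps PO
    by (intro nn_integral_mono) (auto simp: nbhd_def indicator_def intro!: ennreal_leI)
  also have "\<dots> = ennreal (1 / quot k) * emeasure lborel (?O - ?P)
      + (\<integral>\<^sup>+z\<in>?P. ennreal (steepness (dyadic m) z) \<partial>lborel)"
    by (subst nn_integral_add) (auto simp: nn_integral_cmult_indicator)
  also have "emeasure lborel (?O - ?P) = ennreal (vol k - vol (Suc k))"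
    using emeasure_Diff[OF fin _ _ PO] by (simp add: emeasure_compact compact_nbhd X vol_def ennreal_minus)
  also have "ennreal (1 / quot k) * ennreal (vol k - vol (Suc k)) = ennreal ((vol k - vol (Suc k)) / quot k)"
    using vol_Suc_le[of k] quot_pos[of k] by (simp add: ennreal_mult''[symmetric])
  also have "ennreal ((vol k - vol (Suc k)) / quot k) + (\<integral>\<^sup>+z\<in>?P. ennreal (steepness (dyadic m) z) \<partial>lborel)
    \<le> ennreal ((vol k - vol (Suc k)) / quot k) + ennreal (tail m (Suc k))"
    by (intro add_left_mono step.IH)
  also have "\<dots> = ennreal (tail m k)"
    using tail_step[of k m] step.hyps tail_nonneg vol_Suc_le[of k] quot_pos[of k]
    by (simp add: ennreal_plus[symmetric] del: ennreal_plus)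
  finally show ?case .
qed

lemma escape_slices_double_integral_le:
  assumes "k < m"
  defines "r \<equiv> dyadic (Suc k)"
  defines "l \<equiv> 4 * \<omega> (4 * r)" and "B \<equiv> measure lborel (cball (0::'a) r)"
  shows "(\<integral>\<^sup>+a. (\<integral>\<^sup>+u\<in>cball 0 r. emeasure lborel (escape (slice r a) u) \<partial>lborel) \<partial>lborel)
    \<le> ennreal (B * (l * (vol k - vol (Suc k)) + 24 ^ d * r * tail m k))"
proof -
  define K where "K = cball (0::'a) r"
  have [measurable]: "K \<in> sets borel" unfolding K_def by simp
  have r: "0 < r" "2 * r = dyadic k" unfolding r_def by auto
  have l: "0 \<le> l" unfolding l_def using nonneg[of "4 * r"] r by simp
  note esc = emeasure_escape_slice[OF meta_eq_to_obj_eq[OF l_def]]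
  have "(\<integral>\<^sup>+a. (\<integral>\<^sup>+u\<in>K. emeasure lborel (escape (slice r a) u) \<partial>lborel) \<partial>lborel)
    = (\<integral>\<^sup>+u. (\<integral>\<^sup>+a. emeasure lborel (escape (slice r a) u) * indicator K u \<partial>lborel) \<partial>lborel)"
    unfolding esc by (rule lborel_pair.Fubini') measurable
  also have "\<dots> = (\<integral>\<^sup>+u\<in>K. (\<integral>\<^sup>+a. emeasure lborel (escape (slice r a) u) \<partial>lborel) \<partial>lborel)"
  proof (intro nn_integral_cong nn_integral_multc)
    fix u
    show "(\<lambda>a. emeasure lborel (escape (slice r a) u)) \<in> borel_measurable lborel"
      unfolding esc by measurable
  qed
  also have "\<dots> \<le> (\<integral>\<^sup>+u. ennreal (l * (vol k - vol (Suc k)) + 24 ^ d * r * tail m k) * indicator K u \<partial>lborel)"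
  proof (intro nn_integral_mono)
    fix u
    show "(\<integral>\<^sup>+a. emeasure lborel (escape (slice r a) u) \<partial>lborel) * indicator K u
      \<le> ennreal (l * (vol k - vol (Suc k)) + 24 ^ d * r * tail m k) * indicator K u"
    proof (cases "u \<in> K")
      case True
      then have u: "norm u \<le> r" unfolding K_def by simp
      have "(\<integral>\<^sup>+a. emeasure lborel (escape (slice r a) u) \<partial>lborel)
        \<le> ennreal (l * (measure lborel (nbhd X (2 * r)) - measure lborel (nbhd X r)))
        + (\<integral>\<^sup>+z\<in>nbhd X r. ennreal \<bar>ext f X z - ext f X (z + u)\<bar> \<partial>lborel)"
        unfolding l_def by (rule integral_escape_slices_le) (use r u in auto)
      also have "\<dots> \<le> ennreal (l * (measure lborel (nbhd X (2 * r)) - measure lborel (nbhd X r)))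
        + ennreal (24 ^ d * r) * (\<integral>\<^sup>+z\<in>nbhd X (2 * r). ennreal (steepness (dyadic m) z) \<partial>lborel)"
        by (intro add_left_mono integral_ext_diff_le r u) simp
      also have "\<dots> \<le> ennreal (l * (vol k - vol (Suc k))) + ennreal (24 ^ d * r) * ennreal (tail m k)"
        unfolding r(2) unfolding vol_def r_def[symmetric]
        using integral_steepness_le[of k m] assms(1) by (intro add_left_mono mult_left_mono) auto
      also have "\<dots> = ennreal (l * (vol k - vol (Suc k)) + 24 ^ d * r * tail m k)"
        using l r tail_nonneg[of m k] vol_Suc_le[of k] by (simp add: ennreal_mult)
      finally show ?thesis using True by simp
    qed simp
  qed
  also have "\<dots> = ennreal (l * (vol k - vol (Suc k)) + 24 ^ d * r * tail m k) * emeasure lborel K"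
    by (rule nn_integral_cmult_indicator) simp
  also have "\<dots> = ennreal (B * (l * (vol k - vol (Suc k)) + 24 ^ d * r * tail m k))"
    using emeasure_compact[OF compact_cball[of "0::'a" r]] unfolding K_def B_def
    by (simp add: ennreal_mult' mult.commute)
  finally show ?thesis unfolding K_def .
qed

text \<open>
  The double integral over window positions and short translations is bounded below by isoperimetry and above by
  the new volume and the interfaces. The hypothesis \<open>low\<close> makes the volume of a slice large enough compared with
  the ball of radius \<open>2^-(k+1)\<close> for the root in the isoperimetric inequality to dominate the additional 1.
\<close>
lemma growth_inequality:
  assumes k: "k < m" and b: "\<And>Y. compact Y \<Longrightarrow> Y \<noteq> {} \<Longrightarrow> Y \<subseteq> X \<Longrightarrow>
      b * measure lborel (f ` Y) \<le> measure lborel (nbhd Y (dyadic (Suc k)))"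
    and low: "measure lborel (cball (0::'a) (dyadic (Suc k))) \<le> b * (2 * \<omega> (2 * dyadic (Suc k)))"
  shows "weight k * root d b ^ (d - 1) * measure lborel (f ` X)
    \<le> 32 * root d (8 / unit_ball_vol (real d)) * (vol k - vol (Suc k) + 24 ^ d * quot k * tail m k)"
proof -
  define r where "r = dyadic (Suc k)"
  define l where "l = 4 * \<omega> (4 * r)"
  define B where "B = measure lborel (cball (0::'a) r)"
  define v where "v = unit_ball_vol (real d)"
  define E where "E = measure lborel (f ` X)"
  define y where "y = root d b"
  define x where "x = root d (2 * b * l / B)"
  have d: "0 < d" using d_ge_2 by simp
  have r: "0 < r" "2 * r = dyadic k" "4 * r = 2 * dyadic k" unfolding r_def by auto
  have v: "0 < v" unfolding v_def by simp
  have B: "B = v * r ^ d" "0 < B"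
    unfolding B_def v_def using r dim by (auto simp: content_cball)
  have w: "0 < \<omega> (dyadic k)" "\<omega> (dyadic k) \<le> \<omega> (2 * dyadic k)" "\<omega> (2 * dyadic k) \<le> 2 ^ d * \<omega> (dyadic k)"
    using pos[of "dyadic k"] mono[of "dyadic k" "2 * dyadic k"] growth[of 2 "dyadic k"] by auto
  have l: "l = 4 * \<omega> (2 * dyadic k)" "0 < l" unfolding l_def r(3) using w by auto
  have low': "B \<le> b * (2 * \<omega> (dyadic k))"
    using low unfolding B_def r_def[symmetric] r(2) .
  have b0: "0 < b"
  proof (rule ccontr)
    assume "\<not> 0 < b"
    then have "b * (2 * \<omega> (dyadic k)) \<le> 0" using w by (intro mult_nonpos_nonneg) auto
    with low' B show False by simp
  qed
  have "b * (2 * \<omega> (dyadic k)) \<le> b * l" using b0 l w by (intro mult_left_mono) auto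
  with low' have "B \<le> b * l" by linarith
  moreover have "b * l \<le> 2 * b * l" using b0 l(2) by simp
  ultimately have "B \<le> 2 * b * l" by linarith
  then have "1 \<le> 2 * b * l / B" using B(2) by (simp add: le_divide_eq)
  then have x1: "1 \<le> x" unfolding x_def using d by simp
  have ext0: "B * l * (b * E / (4 * (x + 1))) \<le> B * (l * (vol k - vol (Suc k)) + 24 ^ d * r * tail m k)"
  proof -
    have "ennreal (B * l * (b * E / (4 * (x + 1))))
      \<le> (\<integral>\<^sup>+a. (\<integral>\<^sup>+u\<in>cball 0 r. emeasure lborel (escape (slice r a) u) \<partial>lborel) \<partial>lborel)"
      unfolding x_def E_def B_def l_def
      by (rule integral_escape_slices_ge) (use b0 b r in \<open>auto simp: r_def\<close>)
    also have "\<dots> \<le> ennreal (B * (l * (vol k - vol (Suc k)) + 24 ^ d * r * tail m k))"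
      unfolding B_def l_def r_def by (rule escape_slices_double_integral_le[OF k])
    finally show ?thesis
      using B l r tail_nonneg[of m k] vol_Suc_le[of k]
      by (subst (asm) ennreal_le_iff) (auto intro!: mult_nonneg_nonneg add_nonneg_nonneg)
  qed
  \<comment> \<open>Since \<open>x\<close> is at least 1, the term \<open>x + 1\<close> may be replaced by \<open>2 * x\<close>.\<close>
  have "b * E / (8 * x) \<le> b * E / (4 * (x + 1))"
    using x1 b0 unfolding E_def by (intro divide_left_mono) auto
  also have "\<dots> \<le> vol k - vol (Suc k) + 24 ^ d * (r / l) * tail m k"
  proof -
    have "l * (b * E / (4 * (x + 1))) \<le> l * (vol k - vol (Suc k)) + 24 ^ d * r * tail m k"
      using ext0 mult_le_cancel_left_pos[OF B(2), of "l * (b * E / (4 * (x + 1)))"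
          "l * (vol k - vol (Suc k)) + 24 ^ d * r * tail m k"]
      by (simp only: mult.assoc)
    also have "\<dots> = l * (vol k - vol (Suc k) + 24 ^ d * (r / l) * tail m k)"
      using l by (simp add: distrib_left)
    finally show ?thesis using l by (simp only: mult_le_cancel_left_pos)
  qed
  also have "\<dots> \<le> vol k - vol (Suc k) + 24 ^ d * quot k * tail m k"
  proof -
    have "r / l \<le> dyadic k / \<omega> (dyadic k)"
      unfolding l(1) using w r by (intro frac_le) auto
    then show ?thesis unfolding quot_def using tail_nonneg
      by (intro add_left_mono mult_right_mono mult_left_mono) auto
  qed
  finally have main: "b * E / (8 * x) \<le> vol k - vol (Suc k) + 24 ^ d * quot k * tail m k" .
  have y: "0 < y" "y ^ d = b" unfolding y_def using b0 d by auto
  have "x \<le> 4 * root d (8 / v) * y / weight k"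
  proof -
    have "2 * b * l / B \<le> 8 * b * (2 ^ d * \<omega> (dyadic k)) / (v * r ^ d)"
      unfolding B l(1) using w b0 v r by (intro divide_right_mono) auto
    then have "x \<le> root d (8 * b * (2 ^ d * \<omega> (dyadic k)) / (v * r ^ d))"
      unfolding x_def using d by simp
    also have "\<dots> = root d ((8 / v) * b * \<omega> (dyadic k) * (2 / r) ^ d)"
      by (simp add: power_divide mult_ac)
    also have "\<dots> = root d (8 / v) * y * root d (\<omega> (dyadic k)) * (2 / r)"
    proof -
      have "root d ((2 / r) ^ d) = 2 / r" using d r by (intro real_root_power_cancel) auto
      then show ?thesis unfolding y_def by (simp only: real_root_mult)
    qed
    also have "\<dots> = 4 * root d (8 / v) * y / weight k"
      unfolding weight_def using r(2) r(1) by (simp add: field_simps)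
    finally show ?thesis .
  qed
  then have "weight k * x \<le> 4 * root d (8 / v) * y"
    using weight_pos[of k] by (simp add: le_divide_eq mult.commute)
  moreover have "b = y ^ (d - 1) * y" using y d by (metis power_minus_mult)
  ultimately have "weight k * y ^ (d - 1) * E * (8 * x) \<le> 32 * root d (8 / v) * (b * E)"
    using mult_right_mono[of "weight k * x" "4 * root d (8 / v) * y" "8 * y ^ (d - 1) * E"] y
    unfolding E_def by (simp add: mult_ac)
  then have "weight k * y ^ (d - 1) * E \<le> 32 * root d (8 / v) * (b * E) / (8 * x)"
    using x1 by (subst pos_le_divide_eq) auto
  also have "\<dots> = 32 * root d (8 / v) * (b * E / (8 * x))" by simp
  also have "\<dots> \<le> 32 * root d (8 / v) * (vol k - vol (Suc k) + 24 ^ d * quot k * tail m k)"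
    using v d by (intro mult_left_mono main) auto
  finally show ?thesis unfolding y_def E_def v_def .
qed

end

section \<open>Summation over the scales\<close>

lemma power_diff_le:
  fixes x z :: real
  assumes "0 \<le> z" "z \<le> x"
  shows "x ^ Suc n - z ^ Suc n \<le> real (Suc n) * x ^ n * (x - z)"
proof (induction n)
  case (Suc n)
  have "x ^ Suc (Suc n) - z ^ Suc (Suc n) = x * (x ^ Suc n - z ^ Suc n) + z ^ Suc n * (x - z)"
    by (simp add: algebra_simps)
  also have "\<dots> \<le> x * (real (Suc n) * x ^ n * (x - z)) + x ^ Suc n * (x - z)"
    using assms Suc.IH by (intro add_mono mult_left_mono mult_right_mono power_mono) auto
  also have "\<dots> = real (Suc (Suc n)) * x ^ Suc n * (x - z)"
    by (simp add: algebra_simps)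
  finally show ?case .
qed simp

text \<open>
  Let \<open>S j\<close> be the sum in \<open>sum\<close>. The hypotheses give \<open>S j \<le> 2 * C * y (j+1)^d\<close>, hence
  \<open>a j = (S j - S (j+1)) / y (j+1)^(d-1)\<close> is bounded by a multiple of the increment of the \<open>d\<close>-th root of \<open>S\<close>,
  and these increments telescope.
\<close>
lemma bounded_sum_of_self_improving:
  fixes a y :: "nat \<Rightarrow> real"
  assumes d: "0 < d" and C: "0 < C" and a: "\<And>k. 0 \<le> a k" and y: "\<And>k. 0 < y k"
    and sum: "\<And>j. j \<le> m \<Longrightarrow> (\<Sum>k=j..<m. a k * y (Suc k) ^ (d - 1)) \<le> C * y j ^ d"
    and small: "\<And>k. a k \<le> C * y (Suc k)"
  shows "(\<Sum>k<m. a k) \<le> real d * root d (2 * C) ^ (d - 1) * (root d C * y 0)"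
proof -
  define S where "S j = (\<Sum>k=j..<m. a k * y (Suc k) ^ (d - 1))" for j
  define \<sigma> where "\<sigma> j = root d (S j)" for j
  define L where "L = root d (2 * C)"
  have S0: "0 \<le> S j" for j
    unfolding S_def using a y by (intro sum_nonneg mult_nonneg_nonneg) (auto simp: less_imp_le)
  have \<sigma>0: "0 \<le> \<sigma> j" "\<sigma> j ^ d = S j" for j unfolding \<sigma>_def using S0 d by auto
  have L: "0 < L" "L ^ d = 2 * C" unfolding L_def using C d by auto
  obtain n where n: "d = Suc n" using d by (cases d) auto
  have bound: "(\<Sum>k=j..<m. a k) \<le> real d * L ^ (d - 1) * \<sigma> j" if "j \<le> m" for j
    using that
  proof (induction rule: inc_induct)
    case base
    then show ?case using L \<sigma>0 by simp
  next
    case (step j)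
    have S: "S j = a j * y (Suc j) ^ (d - 1) + S (Suc j)"
      unfolding S_def using step.hyps by (simp add: sum.atLeast_Suc_lessThan)
    \<comment> \<open>The first summand uses \<open>small\<close>, the second one the bound for the sum that starts at the next index.\<close>
    have "S j \<le> C * y (Suc j) * y (Suc j) ^ (d - 1) + C * y (Suc j) ^ d"
      unfolding S using sum[of "Suc j"] step.hyps small[of j] y[of "Suc j"]
      by (intro add_mono mult_right_mono) (auto simp: S_def)
    also have "\<dots> = (L * y (Suc j)) ^ d" unfolding power_mult_distrib L(2) by (simp add: n)
    finally have "\<sigma> j \<le> root d ((L * y (Suc j)) ^ d)" unfolding \<sigma>_def using d by simp
    also have "\<dots> = L * y (Suc j)"
      using d L y[of "Suc j"] by (intro real_root_power_cancel) auto
    finally have "\<sigma> j \<le> L * y (Suc j)" .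
    then have \<sigma>p: "\<sigma> j ^ n \<le> (L * y (Suc j)) ^ n" using \<sigma>0 by (intro power_mono) auto
    have le: "\<sigma> (Suc j) \<le> \<sigma> j"
      unfolding \<sigma>_def using S a[of j] y[of "Suc j"] d by simp
    have "a j * y (Suc j) ^ n = \<sigma> j ^ Suc n - \<sigma> (Suc j) ^ Suc n"
      using S \<sigma>0 unfolding n by simp
    also have "\<dots> \<le> real (Suc n) * \<sigma> j ^ n * (\<sigma> j - \<sigma> (Suc j))"
      by (rule power_diff_le[OF \<sigma>0(1) le])
    also have "\<dots> \<le> real (Suc n) * (L * y (Suc j)) ^ n * (\<sigma> j - \<sigma> (Suc j))"
      using \<sigma>p le by (intro mult_right_mono mult_left_mono) auto
    also have "\<dots> = real (Suc n) * L ^ n * (\<sigma> j - \<sigma> (Suc j)) * y (Suc j) ^ n"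
      by (simp add: power_mult_distrib)
    finally have "a j \<le> real (Suc n) * L ^ n * (\<sigma> j - \<sigma> (Suc j))"
      by (rule mult_right_le_imp_le) (use y in simp)
    moreover have "(\<Sum>k=j..<m. a k) = a j + (\<Sum>k=Suc j..<m. a k)"
      using step.hyps by (simp add: sum.atLeast_Suc_lessThan)
    ultimately show ?case using step.IH unfolding n by (simp add: algebra_simps)
  qed
  have "\<sigma> 0 \<le> root d (C * y 0 ^ d)"
    unfolding \<sigma>_def using sum[of 0] d by (simp add: S_def)
  also have "\<dots> = root d C * y 0" using d y[of 0] by (simp add: real_root_mult real_root_power_cancel)
  finally have "real d * L ^ (d - 1) * \<sigma> 0 \<le> real d * L ^ (d - 1) * (root d C * y 0)"
    using L by (intro mult_left_mono) auto
  with bound[of 0] show ?thesis unfolding L_def by (simp add: lessThan_atLeast0)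
qed

context modulus
begin

text \<open>
  The share of a scale counts only as far as \<open>quot\<close> increases there. With this weight \<open>share k * quot k\<close> is at most
  \<open>quot (k+1) - quot k\<close>, which is what lets the interface terms telescope for moduli that are close to linear over
  long ranges of scales.
\<close>
definition share :: "nat \<Rightarrow> real" where
  "share k = 1 - quot k / quot (Suc k)"

lemma quot_mono: "quot k \<le> quot (Suc k)"
proof -
  have "s / \<omega> s \<le> r / \<omega> r" if "0 < r" "r \<le> s" for r s
    using quotient_mono[OF that] that pos[of r] pos[of s] by (simp add: field_simps)
  from this[of "dyadic (Suc k)" "dyadic k"] show ?thesis unfolding quot_def by simp
qed

lemma share_bounds: "0 \<le> share k" "share k \<le> 1"
  unfolding share_def using quot_mono[of k] quot_pos[of k] quot_pos[of "Suc k"] by auto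

lemma quot_Suc_le: "quot (Suc k) \<le> 2 ^ d * quot k"
proof -
  define r where "r = dyadic (Suc k)"
  have r: "0 < r" "dyadic k = 2 * r" unfolding r_def by auto
  have "\<omega> (2 * r) \<le> 2 ^ d * \<omega> r" using growth[of 2 r] r by simp
  moreover have "0 < \<omega> r" "0 < \<omega> (2 * r)" using pos r by auto
  ultimately have "r / \<omega> r \<le> 2 ^ d * (r / \<omega> (2 * r))" using r by (simp add: field_simps)
  also have "\<dots> \<le> 2 ^ d * (2 * r / \<omega> (2 * r))"
    using r \<open>0 < \<omega> (2 * r)\<close> by (intro mult_left_mono divide_right_mono) auto
  finally show ?thesis unfolding quot_def r_def[symmetric] r(2) .
qed

lemma weight_power: "weight k ^ d = dyadic k ^ d / \<omega> (dyadic k)"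
proof -
  have "root d (\<omega> (dyadic k)) ^ d = \<omega> (dyadic k)"
    using d_ge_2 by (intro real_root_pow_pos2 nonneg) auto
  then show ?thesis unfolding weight_def by (simp only: power_divide)
qed

lemma quot_weight: "quot k * dyadic k ^ (d - 1) = weight k ^ d"
  unfolding weight_power quot_def using d_ge_2 by (cases d) auto

lemma weight_mono: "weight (Suc k) \<le> weight k"
proof -
  have "r ^ d / \<omega> r \<le> s ^ d / \<omega> s" if "0 < r" "r \<le> s" for r s
    using monotone_onD[OF ratio, of r s] that pos[of r] pos[of s] by (simp add: field_simps)
  from this[of "dyadic (Suc k)" "dyadic k"] have "weight (Suc k) ^ d \<le> weight k ^ d"
    unfolding weight_power by simp
  then show ?thesis using weight_pos[of k] d_ge_2 power_mono_iff[of "weight (Suc k)" "weight k" d] weight_pos[of "Suc k"]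
    by (simp add: less_imp_le)
qed

text \<open>
  As \<open>quot k / quot (k+1) = (weight k / weight (k+1))^d / 2^(d-1)\<close> and \<open>2^(d-1) \<ge> 2\<close>, the share is at least \<open>1/4\<close>
  unless \<open>(weight (k+1) / weight k)^d < 2/3\<close>. In the latter case the left-hand side is negative. This is where the
  dimension has to exceed one.
\<close>
lemma share_weight_ge:
  "weight k / 4 - (weight k - weight (Suc k)) / (4 * (1 - root d (2 / 3))) \<le> share k * weight k"
proof -
  define \<eta> where "\<eta> = 1 - root d (2 / 3)"
  have d: "0 < d" "d = Suc (d - 1)" "1 \<le> d - 1" using d_ge_2 by auto
  have "root d (2 / 3) < root d 1" using d(1) by (subst real_root_less_iff) auto
  then have \<eta>: "0 < \<eta>" unfolding \<eta>_def using d by simp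
  note p = weight_pos[of k] weight_pos[of "Suc k"] quot_pos[of k] quot_pos[of "Suc k"] weight_mono[of k]
  show ?thesis
  proof (cases "weight k ^ d \<le> 3 / 2 * weight (Suc k) ^ d")
    case True
    have "quot k * dyadic k ^ (d - 1) \<le> 3 / 2 * (quot (Suc k) * dyadic (Suc k) ^ (d - 1))"
      using True unfolding quot_weight .
    also have "dyadic (Suc k) ^ (d - 1) = (1 / 2) ^ (d - 1) * dyadic k ^ (d - 1)"
      by (simp only: power_Suc power_mult_distrib)
    finally have "quot k * dyadic k ^ (d - 1) \<le> 3 / 2 * quot (Suc k) * (1 / 2) ^ (d - 1) * dyadic k ^ (d - 1)"
      by (simp only: mult.assoc)
    then have "quot k \<le> 3 / 2 * quot (Suc k) * (1 / 2) ^ (d - 1)"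
      by (rule mult_right_le_imp_le) simp
    also have "\<dots> \<le> 3 / 2 * quot (Suc k) * (1 / 2) ^ 1"
      using p d by (intro mult_left_mono power_decreasing) auto
    finally have "1 / 4 \<le> share k" unfolding share_def using p by (simp add: field_simps)
    then have "1 / 4 * weight k \<le> share k * weight k" using p by (intro mult_right_mono) auto
    moreover have "0 \<le> (weight k - weight (Suc k)) / (4 * \<eta>)" using p \<eta> by simp
    ultimately show ?thesis unfolding \<eta>_def by linarith
  next
    case False
    then have "weight (Suc k) ^ d \<le> 2 / 3 * weight k ^ d" by simp
    then have "root d (weight (Suc k) ^ d) \<le> root d (2 / 3 * weight k ^ d)" using d by simp
    have "weight (Suc k) \<le> root d (2 / 3) * weight k"
    proof -
      have "root d (weight k ^ d) = weight k" "root d (weight (Suc k) ^ d) = weight (Suc k)"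
        using d p by (auto intro: real_root_power_cancel)
      with \<open>root d (weight (Suc k) ^ d) \<le> _\<close> show ?thesis by (simp only: real_root_mult)
    qed
    then have "\<eta> * weight k \<le> weight k - weight (Suc k)" unfolding \<eta>_def by (simp add: algebra_simps)
    then have "weight k / 4 \<le> (weight k - weight (Suc k)) / (4 * \<eta>)" using \<eta> by (simp add: field_simps)
    moreover have "0 \<le> share k * weight k" using share_bounds[of k] p by simp
    ultimately show ?thesis unfolding \<eta>_def by linarith
  qed
qed

lemma summable_weight_if_share:
  assumes "\<And>m. (\<Sum>k<m. share k * weight k) \<le> C"
  shows "summable weight"
proof (rule summableI_nonneg_bounded)
  fix m
  define c where "c = 4 * (1 - root d (2 / 3))"
  have "root d (2 / 3) < root d 1" using d_ge_2 by (subst real_root_less_iff) auto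
  then have c: "0 < c" unfolding c_def using d_ge_2 by simp
  have "(\<Sum>k<m. weight k / 4 - (weight k - weight (Suc k)) / c) \<le> (\<Sum>k<m. share k * weight k)"
    unfolding c_def by (intro sum_mono share_weight_ge)
  also have "\<dots> \<le> C" by (rule assms)
  also have "(\<Sum>k<m. weight k / 4 - (weight k - weight (Suc k)) / c)
    = (\<Sum>k<m. weight k) / 4 - (weight 0 - weight m) / c"
    unfolding sum_lessThan_telescope'[symmetric]
    by (subst sum_subtractf) (simp only: sum_divide_distrib)
  finally have le: "(\<Sum>k<m. weight k) / 4 - (weight 0 - weight m) / c \<le> C" .
  have "x \<le> 4 * (C + t)" if "x / 4 - t \<le> C" for x t :: real using that by simp
  from this[OF le] have "(\<Sum>k<m. weight k) \<le> 4 * (C + (weight 0 - weight m) / c)" .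
  also have "\<dots> \<le> 4 * (C + weight 0 / c)"
    using c weight_pos[of m] by (simp add: divide_right_mono)
  finally show "(\<Sum>k<m. weight k) \<le> 4 * (C + weight 0 / c)" .
qed (use weight_pos in \<open>simp add: less_imp_le\<close>)

end

context modulus_function
begin

text \<open>
  Summation by parts, as an induction towards coarser scales: the subtracted term \<open>quot j * tail m j\<close> absorbs the
  change of \<open>tail\<close> from one scale to the next.
\<close>
lemma sum_tail_le:
  assumes "j \<le> m"
  shows "(\<Sum>k=j..<m. share k * (quot k * tail m k)) \<le> 2 ^ d * vol j - quot j * tail m j"
  using assms
proof (induction rule: inc_induct)
  case base
  have "1 * vol m \<le> 2 ^ d * vol m" by (intro mult_right_mono vol_nonneg) simp
  then show ?case using quot_pos[of m] by (simp add: tail_def)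
next
  case (step j)
  note q = quot_pos[of j] quot_pos[of "Suc j"]
  have "share j * quot j \<le> share j * quot (Suc j)"
    using quot_mono share_bounds by (intro mult_left_mono) auto
  also have "\<dots> = quot (Suc j) - quot j" unfolding share_def using q by (simp add: field_simps)
  finally have "share j * quot j * tail m j \<le> (quot (Suc j) - quot j) * tail m j"
    by (intro mult_right_mono tail_nonneg)
  also have "\<dots> = quot (Suc j) / quot j * (vol j - vol (Suc j)) + quot (Suc j) * tail m (Suc j) - quot j * tail m j"
  proof -
    have "quot (Suc j) * tail m j = quot (Suc j) / quot j * (vol j - vol (Suc j)) + quot (Suc j) * tail m (Suc j)"
      using tail_step[of j m] step.hyps by (simp add: distrib_left)
    then show ?thesis unfolding left_diff_distrib by simp
  qed
  also have "quot (Suc j) / quot j * (vol j - vol (Suc j)) \<le> 2 ^ d * (vol j - vol (Suc j))"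
    using quot_Suc_le[of j] vol_Suc_le[of j] q by (intro mult_right_mono) (auto simp: field_simps)
  finally have "share j * (quot j * tail m j)
    \<le> 2 ^ d * (vol j - vol (Suc j)) + quot (Suc j) * tail m (Suc j) - quot j * tail m j"
    by (simp add: mult.assoc)
  moreover have "(\<Sum>k=j..<m. share k * (quot k * tail m k))
    = share j * (quot j * tail m j) + (\<Sum>k=Suc j..<m. share k * (quot k * tail m k))"
    using step.hyps by (simp add: sum.atLeast_Suc_lessThan)
  ultimately show ?case using step.IH by (simp add: right_diff_distrib)
qed

lemma sum_vol_diff_le:
  assumes "j \<le> m"
  shows "(\<Sum>k=j..<m. share k * (vol k - vol (Suc k))) \<le> vol j"
proof -
  have "(\<Sum>k=j..<m. share k * (vol k - vol (Suc k))) \<le> (\<Sum>k=j..<m. vol k - vol (Suc k))"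
    using share_bounds vol_Suc_le by (intro sum_mono mult_left_le_one_le) auto
  also have "\<dots> = vol j - vol m" using assms by (rule sum_Suc_diff'[where f = "\<lambda>k. - vol k", simplified])
  finally show ?thesis using vol_nonneg[of m] by linarith
qed

lemma summed_growth:
  assumes "j \<le> m"
    and b: "\<And>Y k. compact Y \<Longrightarrow> Y \<noteq> {} \<Longrightarrow> Y \<subseteq> X \<Longrightarrow>
      b k * measure lborel (f ` Y) \<le> measure lborel (nbhd Y (dyadic k))"
    and low: "\<And>k. measure lborel (cball (0::'a) (dyadic k)) \<le> b k * (2 * \<omega> (2 * dyadic k))"
  shows "(\<Sum>k=j..<m. share k * weight k * root d (b (Suc k)) ^ (d - 1)) * measure lborel (f ` X)
    \<le> 32 * root d (8 / unit_ball_vol (real d)) * (1 + 24 ^ d * 2 ^ d) * vol j"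
proof -
  define c where "c = 32 * root d (8 / unit_ball_vol (real d))"
  define E where "E = measure lborel (f ` X)"
  have c: "0 \<le> c" unfolding c_def by (intro mult_nonneg_nonneg real_root_ge_zero) auto
  have "(\<Sum>k=j..<m. share k * weight k * root d (b (Suc k)) ^ (d - 1)) * E
    = (\<Sum>k=j..<m. share k * (weight k * root d (b (Suc k)) ^ (d - 1) * E))"
    by (simp add: sum_distrib_right mult.assoc)
  also have "\<dots> \<le> (\<Sum>k=j..<m. share k * (c * (vol k - vol (Suc k) + 24 ^ d * quot k * tail m k)))"
    unfolding c_def E_def
    using share_bounds by (intro sum_mono mult_left_mono growth_inequality b low) auto
  also have "\<dots> = c * ((\<Sum>k=j..<m. share k * (vol k - vol (Suc k)))
      + 24 ^ d * (\<Sum>k=j..<m. share k * (quot k * tail m k)))"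
    unfolding sum_distrib_left sum.distrib[symmetric] by (intro sum.cong) (auto simp: algebra_simps)
  also have "\<dots> \<le> c * (vol j + 24 ^ d * (2 ^ d * vol j))"
  proof (intro mult_left_mono add_mono c sum_vol_diff_le assms)
    have "0 \<le> quot j * tail m j" using quot_pos[of j] tail_nonneg[of m j] by simp
    then show "(\<Sum>k=j..<m. share k * (quot k * tail m k)) \<le> 2 ^ d * vol j"
      using sum_tail_le[OF assms(1)] by linarith
  qed simp
  also have "\<dots> = c * (1 + 24 ^ d * 2 ^ d) * vol j" by (simp add: algebra_simps)
  finally show ?thesis unfolding c_def E_def .
qed

end

section \<open>Images that are not null force a finite integral\<close>

context modulus_function
begin

text \<open>
  Taking the infimum over all compact subsets makes the isoperimetric lower bound available for every slice of
  every subset, however unevenly the volume is distributed over the windows.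
\<close>
definition thickness :: "nat \<Rightarrow> real" where
  "thickness k = Inf ((\<lambda>Y. measure lborel (nbhd Y (dyadic k)) / measure lborel (f ` Y)) `
    {Y. compact Y \<and> Y \<noteq> {} \<and> Y \<subseteq> X \<and> 0 < measure lborel (f ` Y)})"

lemma restrict:
  assumes "compact Y" "Y \<noteq> {}" "Y \<subseteq> X"
  shows "modulus_function \<omega> d f Y"
  using assms f dim by unfold_locales (auto simp: has_modulus_of_continuity_def)

lemma thickness_mult_le:
  assumes "compact Y" "Y \<noteq> {}" "Y \<subseteq> X"
  shows "thickness k * measure lborel (f ` Y) \<le> measure lborel (nbhd Y (dyadic k))"
proof (cases "0 < measure lborel (f ` Y)")
  case True
  have "thickness k \<le> measure lborel (nbhd Y (dyadic k)) / measure lborel (f ` Y)"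
    unfolding thickness_def using assms True
    by (intro cInf_lower imageI bdd_belowI[of _ 0]) auto
  then show ?thesis using True by (simp add: le_divide_eq)
qed (use measure_nonneg[of lborel "f ` Y"] in auto)

lemma thickness_greatest:
  assumes "0 < measure lborel (f ` X)"
    and "\<And>Y. compact Y \<Longrightarrow> Y \<noteq> {} \<Longrightarrow> Y \<subseteq> X \<Longrightarrow> 0 < measure lborel (f ` Y) \<Longrightarrow>
      C * measure lborel (f ` Y) \<le> measure lborel (nbhd Y (dyadic k))"
  shows "C \<le> thickness k"
  unfolding thickness_def
proof (rule cInf_greatest)
  show "(\<lambda>Y. measure lborel (nbhd Y (dyadic k)) / measure lborel (f ` Y)) `
    {Y. compact Y \<and> Y \<noteq> {} \<and> Y \<subseteq> X \<and> 0 < measure lborel (f ` Y)} \<noteq> {}"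
    using assms(1) X by blast
next
  fix q assume "q \<in> (\<lambda>Y. measure lborel (nbhd Y (dyadic k)) / measure lborel (f ` Y)) `
    {Y. compact Y \<and> Y \<noteq> {} \<and> Y \<subseteq> X \<and> 0 < measure lborel (f ` Y)}"
  then obtain Y where Y: "compact Y" "Y \<noteq> {}" "Y \<subseteq> X" "0 < measure lborel (f ` Y)"
    and q: "q = measure lborel (nbhd Y (dyadic k)) / measure lborel (f ` Y)" by blast
  show "C \<le> q" unfolding q using assms(2)[OF Y] Y(4) by (simp only: pos_le_divide_eq)
qed

text \<open>
  Consequently the thickness is positive, and at the scale \<open>k + 1\<close> it is at least a constant times \<open>(weight k)^d\<close>.
\<close>
lemma thickness_ge:
  assumes "0 < measure lborel (f ` X)"
  shows "measure lborel (cball (0::'a) (dyadic k)) \<le> thickness k * (2 * \<omega> (2 * dyadic k))"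
proof -
  have w: "0 < 2 * \<omega> (2 * dyadic k)" using pos[of "2 * dyadic k"] by simp
  have "measure lborel (cball (0::'a) (dyadic k)) / (2 * \<omega> (2 * dyadic k)) \<le> thickness k"
  proof (rule thickness_greatest[OF assms])
    fix Y assume Y: "compact Y" "Y \<noteq> {}" "Y \<subseteq> X"
    interpret Y: modulus_function \<omega> d f Y by (rule restrict[OF Y])
    have "measure lborel (f ` Y) * measure lborel (cball (0::'a) (dyadic k))
      \<le> 2 * \<omega> (2 * dyadic k) * measure lborel (nbhd Y (dyadic k))"
      by (rule Y.measure_nbhd_ge) simp
    then show "measure lborel (cball (0::'a) (dyadic k)) / (2 * \<omega> (2 * dyadic k)) * measure lborel (f ` Y)
      \<le> measure lborel (nbhd Y (dyadic k))"
      using w by (simp add: divide_le_eq mult_ac)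
  qed
  then show ?thesis using w by (simp only: pos_divide_le_eq)
qed

text \<open>
  The \<open>d\<close>-th roots \<open>y\<close> of the thickness form a self-improving sequence: apply the summed growth inequality to an
  arbitrary compact subset and take the infimum.
\<close>
lemma summable_weight:
  assumes E: "0 < measure lborel (f ` X)"
  shows "summable weight"
proof (rule summable_weight_if_share)
  fix m
  define v where "v = unit_ball_vol (real d)"
  define C1 where "C1 = 32 * root d (8 / v) * (1 + 24 ^ d * 2 ^ d)"
  define C2 where "C2 = root d (2 ^ Suc d / v)"
  define C where "C = max C1 C2"
  define y where "y k = root d (thickness k)" for k
  have d: "0 < d" using d_ge_2 by simp
  have v: "0 < v" unfolding v_def by simp
  have C1: "0 < C1" unfolding C1_def using v d by (intro mult_pos_pos add_pos_pos) auto
  have C: "0 < C" "C1 \<le> C" "C2 \<le> C" unfolding C_def using C1 by auto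
  have ball: "measure lborel (cball (0::'a) (dyadic k)) = v * dyadic k ^ d" for k
    unfolding v_def using dim by (simp add: content_cball)
  have low: "v / 2 ^ Suc d * weight k ^ d \<le> thickness (Suc k)" for k
  proof -
    have "v * dyadic (Suc k) ^ d \<le> thickness (Suc k) * (2 * \<omega> (2 * dyadic (Suc k)))"
      using thickness_ge[OF E, of "Suc k"] unfolding ball .
    also have "2 * dyadic (Suc k) = dyadic k" by simp
    also have "dyadic (Suc k) ^ d = dyadic k ^ d / 2 ^ d" by (simp add: power_divide power_mult_distrib)
    finally show ?thesis
      unfolding weight_power using pos[of "dyadic k"] by (simp add: field_simps)
  qed
  have dens0: "0 < thickness k" for k
  proof -
    have "0 < measure lborel (cball (0::'a) (dyadic k))" unfolding ball using v by simp
    then have "0 < thickness k * (2 * \<omega> (2 * dyadic k))" using thickness_ge[OF E, of k] by linarith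
    then show ?thesis using pos[of "2 * dyadic k"] by (simp add: zero_less_mult_iff)
  qed
  have y: "0 < y k" "y k ^ d = thickness k" for k unfolding y_def using dens0[of k] d by auto
  have small: "share k * weight k \<le> C * y (Suc k)" for k
  proof -
    have "weight k ^ d \<le> 2 ^ Suc d / v * thickness (Suc k)"
      using low[of k] v by (simp add: field_simps)
    then have "root d (weight k ^ d) \<le> root d (2 ^ Suc d / v * thickness (Suc k))" using d by simp
    moreover have "root d (weight k ^ d) = weight k"
      using d weight_pos[of k] by (intro real_root_power_cancel) auto
    ultimately have "weight k \<le> C2 * y (Suc k)"
      unfolding C2_def y_def by (simp only: real_root_mult)
    also have "\<dots> \<le> C * y (Suc k)" using C y(1)[of "Suc k"] by (intro mult_right_mono) auto
    finally show ?thesis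
      using share_bounds[of k] weight_pos[of k] mult_left_le_one_le[of "weight k" "share k"] by linarith
  qed
  have sum: "(\<Sum>k=j..<m. share k * weight k * y (Suc k) ^ (d - 1)) \<le> C * y j ^ d" if "j \<le> m" for j
  proof -
    have "(\<Sum>k=j..<m. share k * weight k * y (Suc k) ^ (d - 1)) / C1 \<le> thickness j"
    proof (rule thickness_greatest[OF E])
      fix Y assume Y: "compact Y" "Y \<noteq> {}" "Y \<subseteq> X"
      interpret Y: modulus_function \<omega> d f Y by (rule restrict[OF Y])
      have "(\<Sum>k=j..<m. share k * weight k * y (Suc k) ^ (d - 1)) * measure lborel (f ` Y) \<le> C1 * Y.vol j"
        unfolding y_def C1_def v_def
      proof (rule Y.summed_growth[OF that])
        fix Z k assume "compact Z" "Z \<noteq> {}" "Z \<subseteq> Y"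
        then show "thickness k * measure lborel (f ` Z) \<le> measure lborel (nbhd Z (dyadic k))"
          using Y(3) by (intro thickness_mult_le) auto
      qed (rule thickness_ge[OF E])
      then show "(\<Sum>k=j..<m. share k * weight k * y (Suc k) ^ (d - 1)) / C1 * measure lborel (f ` Y)
        \<le> measure lborel (nbhd Y (dyadic j))"
        unfolding Y.vol_def[symmetric] using C1 by (simp add: divide_le_eq mult_ac)
    qed
    then have "(\<Sum>k=j..<m. share k * weight k * y (Suc k) ^ (d - 1)) \<le> C1 * thickness j"
      using C1 by (simp add: divide_le_eq mult.commute)
    also have "\<dots> \<le> C * thickness j" using C dens0[of j] by (intro mult_right_mono) auto
    finally show ?thesis unfolding y(2) .
  qed
  have nn: "0 \<le> share k * weight k" for k
    using share_bounds[of k] weight_pos[of k] by simp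
  show "(\<Sum>k<m. share k * weight k) \<le> real d * root d (2 * C) ^ (d - 1) * (root d C * y 0)"
    by (rule bounded_sum_of_self_improving[OF d C(1) nn y(1) sum small])
qed

end

context modulus
begin

text \<open>
  A modulus that vanishes continuously at 0 makes the function uniformly continuous, and the inequality passes to
  limits.
\<close>
lemma modulus_closure:
  fixes f :: "'a::euclidean_space \<Rightarrow> real"
  assumes f: "has_modulus_of_continuity f A \<omega>"
  obtains g where "\<And>x. x \<in> A \<Longrightarrow> g x = f x" "has_modulus_of_continuity g (closure A) \<omega>"
proof -
  have "uniformly_continuous_on A f"
    unfolding uniformly_continuous_on_def
  proof (intro allI impI)
    fix e :: real assume e: "0 < e"
    obtain \<delta> where \<delta>: "0 < \<delta>" "\<And>r. r \<in> {0..} \<Longrightarrow> dist r 0 < \<delta> \<Longrightarrow> dist (\<omega> r) (\<omega> 0) < e"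
      using cont[unfolded continuous_on_iff, rule_format, of 0 e] e by auto
    have "dist (f y) (f x) < e" if "x \<in> A" "y \<in> A" "dist y x < \<delta>" for x y
    proof -
      have "dist (f y) (f x) \<le> \<omega> (dist y x)"
        using f that unfolding has_modulus_of_continuity_def dist_real_def by auto
      also have "\<dots> < e" using \<delta>(2)[of "dist y x"] that by (simp add: dist_real_def)
      finally show ?thesis .
    qed
    with \<delta>(1) show "\<exists>\<delta>>0. \<forall>x\<in>A. \<forall>y\<in>A. dist y x < \<delta> \<longrightarrow> dist (f y) (f x) < e" by blast
  qed
  then obtain g where g: "uniformly_continuous_on (closure A) g" "\<And>x. x \<in> A \<Longrightarrow> f x = g x"
    by (rule uniformly_continuous_on_extension_on_closure) blast
  have gc: "continuous_on (closure A) g" by (rule uniformly_continuous_imp_continuous[OF g(1)])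
  have "\<bar>g x - g y\<bar> \<le> \<omega> (dist x y)" if xy: "x \<in> closure A" "y \<in> closure A" for x y
  proof -
    obtain u where u: "\<And>n. u n \<in> A" "u \<longlonglongrightarrow> x" using xy(1) unfolding closure_sequential by blast
    obtain w where w: "\<And>n. w n \<in> A" "w \<longlonglongrightarrow> y" using xy(2) unfolding closure_sequential by blast
    have cl: "A \<subseteq> closure A" by (rule closure_subset)
    have "(\<lambda>n. g (u n)) \<longlonglongrightarrow> g x" "(\<lambda>n. g (w n)) \<longlonglongrightarrow> g y"
      using u w cl xy by (auto intro!: continuous_on_tendsto_compose[OF gc] always_eventually)
    then have "(\<lambda>n. \<bar>g (u n) - g (w n)\<bar>) \<longlonglongrightarrow> \<bar>g x - g y\<bar>" by (intro tendsto_intros)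
    moreover have "(\<lambda>n. \<omega> (dist (u n) (w n))) \<longlonglongrightarrow> \<omega> (dist x y)"
      using u w by (intro continuous_on_tendsto_compose[OF cont] tendsto_intros) auto
    moreover have "\<bar>g (u n) - g (w n)\<bar> \<le> \<omega> (dist (u n) (w n))" for n
      using f u(1)[of n] w(1)[of n] g(2) unfolding has_modulus_of_continuity_def by fastforce
    ultimately show ?thesis by (intro LIMSEQ_le) auto
  qed
  then have "has_modulus_of_continuity g (closure A) \<omega>" unfolding has_modulus_of_continuity_def by blast
  with g(2) show ?thesis by (intro that[of g]) auto
qed

lemma summable_weight_if_image_not_null:
  fixes f :: "'a::euclidean_space \<Rightarrow> real"
  assumes dim: "DIM('a) = d" and f: "has_modulus_of_continuity f A \<omega>"
    and image: "f ` A \<notin> null_sets lebesgue"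
  shows "summable weight"
proof -
  have "\<exists>n. f ` (A \<inter> cball 0 (real n)) \<notin> null_sets lebesgue"
  proof (rule ccontr)
    assume "\<not> ?thesis"
    then have "(\<Union>n. f ` (A \<inter> cball 0 (real n))) \<in> null_sets lebesgue" by (intro null_sets_UN) auto
    moreover have "f ` A = (\<Union>n. f ` (A \<inter> cball 0 (real n)))"
    proof -
      have "A = (\<Union>n. A \<inter> cball 0 (real n))" using real_arch_simple by auto
      then have "f ` A = f ` (\<Union>n. A \<inter> cball 0 (real n))" by simp
      then show ?thesis by (simp only: image_UN)
    qed
    ultimately show False using image by simp
  qed
  then obtain n where n: "f ` (A \<inter> cball 0 (real n)) \<notin> null_sets lebesgue" by blast
  define A' where "A' = A \<inter> cball 0 (real n)"
  have "has_modulus_of_continuity f A' \<omega>"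
    using f unfolding has_modulus_of_continuity_def A'_def by auto
  then obtain g where g: "\<And>x. x \<in> A' \<Longrightarrow> g x = f x" "has_modulus_of_continuity g (closure A') \<omega>"
    by (rule modulus_closure) blast
  have "bounded A'" unfolding A'_def by (rule bounded_Int) simp
  then have X: "compact (closure A')" by (simp add: compact_closure)
  have "A' \<noteq> {}" using n unfolding A'_def by auto
  then have "closure A' \<noteq> {}" by simp
  then interpret X: modulus_function \<omega> d g "closure A'"
    using dim X g(2) by unfold_locales auto
  have "0 < measure lborel (g ` closure A')"
  proof (rule ccontr)
    assume "\<not> ?thesis"
    then have "measure lborel (g ` closure A') = 0" using measure_nonneg[of lborel "g ` closure A'"] by linarith
    then have "g ` closure A' \<in> null_sets lborel"
      using emeasure_compact[OF X.compact_image] X.compact_image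
      by (auto simp: null_sets_def intro!: borel_closed compact_imp_closed)
    moreover have "f ` A' \<subseteq> g ` closure A'" using g(1) closure_subset[of A'] by force
    ultimately have "f ` A' \<in> null_sets lebesgue"
      by (meson null_sets_completionI null_sets_completion_subset)
    with n show False unfolding A'_def by simp
  qed
  then show ?thesis by (rule X.summable_weight)
qed

lemma powr_eq_root: "0 < x \<Longrightarrow> x powr (- 1 / real d) = 1 / root d x"
  using d_ge_2 by (simp add: root_powr_inverse powr_minus_divide)

lemma integral_finite_if_summable:
  assumes "summable weight"
  shows "(\<integral>\<^sup>+r\<in>{0<..<1}. ennreal (\<omega> r powr (- 1 / real d)) \<partial>lborel) < \<infinity>"
proof -
  define c where "c k = 1 / root d (\<omega> (dyadic (Suc k)))" for k
  have c: "0 < c k" for k unfolding c_def using pos[of "dyadic (Suc k)"] d_ge_2 by simp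
  have "ennreal (\<omega> r powr (- 1 / real d)) * indicator {0<..<1} r
    \<le> (\<Sum>k. ennreal (c k) * indicator {dyadic (Suc k)<..dyadic k} r)" for r
  proof (cases "r \<in> {0<..<1}")
    case True
    then obtain n where n: "dyadic n < r" using real_arch_pow_inv[of r "1 / 2"] by auto
    define N where "N = (LEAST n. dyadic n < r)"
    have N: "dyadic N < r" unfolding N_def by (rule LeastI[of _ n]) (rule n)
    with True obtain k where k: "N = Suc k" by (cases N) auto
    \<comment> \<open>The dyadic interval that contains \<open>r\<close>.\<close>
    have rk: "dyadic (Suc k) < r" "r \<le> dyadic k"
      using N k not_less_Least[of k "\<lambda>n. dyadic n < r"] unfolding N_def[symmetric] by (auto simp del: power_Suc)
    have p: "0 < \<omega> (dyadic (Suc k))" by (rule pos) simp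
    have "\<omega> (dyadic (Suc k)) \<le> \<omega> r" by (intro mono less_imp_le[OF rk(1)]) simp
    then have "\<omega> r powr (- 1 / real d) \<le> \<omega> (dyadic (Suc k)) powr (- 1 / real d)"
      using p by (intro powr_mono2') auto
    also have "\<dots> = c k" unfolding c_def by (rule powr_eq_root[OF p])
    finally have "ennreal (\<omega> r powr (- 1 / real d)) * indicator {0<..<1} r
      \<le> ennreal (c k) * indicator {dyadic (Suc k)<..dyadic k} r"
      using rk True by (simp add: ennreal_leI del: power_Suc)
    also have "\<dots> \<le> (\<Sum>k. ennreal (c k) * indicator {dyadic (Suc k)<..dyadic k} r)"
    proof -
      have "(\<Sum>k\<in>{k}. ennreal (c k) * indicator {dyadic (Suc k)<..dyadic k} r)
        \<le> (\<Sum>k. ennreal (c k) * indicator {dyadic (Suc k)<..dyadic k} r)"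
        by (rule sum_le_suminf) auto
      then show ?thesis by (simp only: sum.insert[OF finite.emptyI] sum.empty add_0_right empty_iff not_False_eq_True)
    qed
    finally show ?thesis .
  qed simp
  then have "(\<integral>\<^sup>+r\<in>{0<..<1}. ennreal (\<omega> r powr (- 1 / real d)) \<partial>lborel)
    \<le> (\<integral>\<^sup>+r. (\<Sum>k. ennreal (c k) * indicator {dyadic (Suc k)<..dyadic k} r) \<partial>lborel)"
    by (intro nn_integral_mono)
  also have "\<dots> = (\<Sum>k. \<integral>\<^sup>+r. ennreal (c k) * indicator {dyadic (Suc k)<..dyadic k} r \<partial>lborel)"
    by (rule nn_integral_suminf) measurable
  also have "\<dots> = (\<Sum>k. ennreal (weight (Suc k)))"
  proof (intro suminf_cong)
    fix k
    have "(\<integral>\<^sup>+r. ennreal (c k) * indicator {dyadic (Suc k)<..dyadic k} r \<partial>lborel)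
      = ennreal (c k) * emeasure lborel {dyadic (Suc k)<..dyadic k}"
      by (rule nn_integral_cmult_indicator) simp
    also have "emeasure lborel {dyadic (Suc k)<..dyadic k} = ennreal (dyadic (Suc k))"
      by simp
    also have "ennreal (c k) * ennreal (dyadic (Suc k)) = ennreal (weight (Suc k))"
      using c[of k] unfolding c_def weight_def by (subst ennreal_mult[symmetric]) auto
    finally show "(\<integral>\<^sup>+r. ennreal (c k) * indicator {dyadic (Suc k)<..dyadic k} r \<partial>lborel)
      = ennreal (weight (Suc k))" .
  qed
  also have "\<dots> < \<infinity>"
    using assms weight_pos summable_Suc_iff[of weight]
    by (subst suminf_ennreal2) (auto simp: less_imp_le)
  finally show ?thesis .
qed

end

section \<open>A Cantor set with an interval as image\<close>

text \<open>
  The digit of \<open>s\<close> at the place \<open>2^-(m+1)\<close> of its binary expansion.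
\<close>
definition binary_digit :: "nat \<Rightarrow> real \<Rightarrow> int" where
  "binary_digit m s = \<lfloor>2 ^ Suc m * s\<rfloor> - 2 * \<lfloor>2 ^ m * s\<rfloor>"

lemma bit_cases: "binary_digit m s = 0 \<or> binary_digit m s = 1"
proof -
  have "(2::real) ^ Suc m * s = 2 * (2 ^ m * s)" by simp
  then show ?thesis unfolding binary_digit_def by linarith
qed

lemma floor_eq_if_bits_eq:
  assumes "s \<in> {0..<1}" "t \<in> {0..<1}" "\<And>k. k < m \<Longrightarrow> binary_digit k s = binary_digit k t"
  shows "\<lfloor>2 ^ m * s\<rfloor> = \<lfloor>2 ^ m * t\<rfloor>"
  using assms(3)
proof (induction m)
  case 0
  have "\<lfloor>s\<rfloor> = 0" "\<lfloor>t\<rfloor> = 0" using assms(1,2) by (simp_all add: floor_eq_iff)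
  then show ?case by simp
next
  case (Suc m)
  then have "\<lfloor>2 ^ m * s\<rfloor> = \<lfloor>2 ^ m * t\<rfloor>" "binary_digit m s = binary_digit m t" by auto
  then show ?case unfolding binary_digit_def by linarith
qed

lemma dist_less_if_bits_eq:
  assumes "s \<in> {0..<1}" "t \<in> {0..<1}" "\<And>k. k < m \<Longrightarrow> binary_digit k s = binary_digit k t"
  shows "\<bar>s - t\<bar> < (1 / 2) ^ m"
proof -
  have "\<lfloor>2 ^ m * s\<rfloor> = \<lfloor>2 ^ m * t\<rfloor>" by (rule floor_eq_if_bits_eq[OF assms])
  then have "\<bar>2 ^ m * s - 2 ^ m * t\<bar> < 1" by linarith
  then have "2 ^ m * \<bar>s - t\<bar> < 1"
    by (simp add: abs_mult right_diff_distrib[symmetric])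
  then show ?thesis by (simp add: field_simps)
qed

lemma first_differing_bit:
  assumes "s \<in> {0..<1}" "t \<in> {0..<1}" "s \<noteq> t"
  obtains m where "binary_digit m s \<noteq> binary_digit m t" "\<And>k. k < m \<Longrightarrow> binary_digit k s = binary_digit k t"
proof -
  have "\<exists>m. binary_digit m s \<noteq> binary_digit m t"
  proof (rule ccontr)
    assume "\<not> ?thesis"
    then have "\<bar>s - t\<bar> < (1 / 2) ^ m" for m using dist_less_if_bits_eq[OF assms(1,2)] by auto
    moreover obtain m where "(1 / 2) ^ m < \<bar>s - t\<bar>"
      using real_arch_pow_inv[of "\<bar>s - t\<bar>" "1 / 2"] assms(3) by auto
    ultimately show False by (meson less_asym)
  qed
  then have "binary_digit (LEAST m. binary_digit m s \<noteq> binary_digit m t) s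
      \<noteq> binary_digit (LEAST m. binary_digit m s \<noteq> binary_digit m t) t"
    by (rule LeastI_ex)
  moreover have "binary_digit k s = binary_digit k t"
    if "k < (LEAST m. binary_digit m s \<noteq> binary_digit m t)" for k
    using not_less_Least[OF that] by simp
  ultimately show ?thesis by (rule that)
qed

context
  fixes r :: "nat \<Rightarrow> real" and d :: nat
  assumes d: "0 < d" and r: "\<And>j. 0 < r j" and summable: "summable (\<lambda>j. 2 ^ j * r j)"
begin

text \<open>
  The digits \<open>j * d + i\<close> with \<open>i < d\<close> tell which of the two halves of a cube of generation \<open>j\<close> is chosen in
  direction \<open>i\<close>; the halves are offset by \<open>side j / 2^j\<close>. The choice of \<open>side\<close> is dictated by
  \<open>side j - side (j+1) = 2^j * r j\<close>: the offset exceeds all later offsets together by the gap \<open>r j\<close>.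
\<close>
definition side :: "nat \<Rightarrow> real" where
  "side j = (\<Sum>k. 2 ^ (k + j) * r (k + j))"

definition digit :: "nat \<Rightarrow> real \<Rightarrow> nat \<Rightarrow> real" where
  "digit i s j = of_int (binary_digit (j * d + i) s) * (side j * (1 / 2) ^ j)"

definition coord :: "nat \<Rightarrow> real \<Rightarrow> real" where
  "coord i s = (\<Sum>j. digit i s j)"

lemma side_nonneg: "0 \<le> side j"
  unfolding side_def using summable r by (intro suminf_nonneg summable_ignore_initial_segment) (auto simp: less_imp_le)

lemma side_Suc: "side j = 2 ^ j * r j + side (Suc j)"
  using suminf_split_head[OF summable_ignore_initial_segment[OF summable, of j]]
  unfolding side_def by simp

lemma side_mono:
  assumes "j \<le> k"
  shows "side k \<le> side j"
proof (rule lift_Suc_antimono_le[OF _ assms])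
  fix n
  have "0 < 2 ^ n * r n" using r[of n] by simp
  then show "side (Suc n) \<le> side n" using side_Suc[of n] by linarith
qed

lemma bit_le: "\<bar>of_int (binary_digit m s) :: real\<bar> \<le> 1"
  using bit_cases[of m s] by auto

lemma digit_le: "\<bar>digit i s j\<bar> \<le> side 0 * (1 / 2) ^ j"
proof -
  have "\<bar>digit i s j\<bar> \<le> 1 * (side j * (1 / 2) ^ j)"
    unfolding digit_def abs_mult using side_nonneg[of j] bit_le
    by (intro mult_mono) auto
  also have "\<dots> \<le> side 0 * (1 / 2) ^ j" using side_mono[of 0 j] by simp
  finally show ?thesis .
qed

lemma summable_digit: "summable (digit i s)"
proof (rule summable_comparison_test')
  show "summable (\<lambda>j. side 0 * (1 / 2) ^ j)" by (intro summable_mult summable_geometric) simp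
  show "norm (digit i s j) \<le> side 0 * (1 / 2) ^ j" if "j \<ge> 0" for j using digit_le by simp
qed

lemma coord_diff_ge:
  assumes i: "i < d" and differ: "binary_digit (j * d + i) s \<noteq> binary_digit (j * d + i) t"
    and agree: "\<And>k. k < j * d + i \<Longrightarrow> binary_digit k s = binary_digit k t"
  shows "r j \<le> \<bar>coord i s - coord i t\<bar>"
proof -
  define D where "D k = digit i s k - digit i t k" for k
  have sD: "summable D" unfolding D_def by (intro summable_diff summable_digit)
  have "coord i s - coord i t = (\<Sum>k. D k)"
    unfolding coord_def D_def by (intro suminf_diff summable_digit)
  also have "\<dots> = (\<Sum>k. D (k + Suc j)) + (\<Sum>k<Suc j. D k)"
    by (rule suminf_split_initial_segment[OF sD])
  also have "(\<Sum>k<Suc j. D k) = D j"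
  proof -
    have "D k = 0" if "k < j" for k
    proof -
      have "k * d + i < j * d + i" using that d by simp
      then show ?thesis unfolding D_def digit_def using agree by simp
    qed
    then show ?thesis by simp
  qed
  finally have split: "coord i s - coord i t = (\<Sum>k. D (k + Suc j)) + D j" .
  have "\<bar>(of_int (binary_digit (j * d + i) s) - of_int (binary_digit (j * d + i) t) :: real)\<bar> = 1"
    using differ bit_cases[of "j * d + i" s] bit_cases[of "j * d + i" t] by auto
  then have Dj: "\<bar>D j\<bar> = side j * (1 / 2) ^ j"
    unfolding D_def digit_def left_diff_distrib[symmetric] abs_mult using side_nonneg by simp
  have Dk: "\<bar>D (k + Suc j)\<bar> \<le> side (Suc j) * (1 / 2) ^ Suc j * (1 / 2) ^ k" for k
  proof -
    have "\<bar>(of_int (binary_digit m s) - of_int (binary_digit m t) :: real)\<bar> \<le> 1" for m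
      using bit_cases[of m s] bit_cases[of m t] by auto
    then have "\<bar>D (k + Suc j)\<bar> \<le> 1 * (side (k + Suc j) * (1 / 2) ^ (k + Suc j))"
      unfolding D_def digit_def left_diff_distrib[symmetric] abs_mult
      using side_nonneg by (intro mult_mono) auto
    also have "\<dots> \<le> side (Suc j) * (1 / 2) ^ (k + Suc j)"
      using side_mono[of "Suc j" "k + Suc j"] by (simp add: mult_right_mono)
    finally show ?thesis by (simp add: power_add mult_ac)
  qed
  have geo: "(\<lambda>k. side (Suc j) * (1 / 2) ^ Suc j * (1 / 2) ^ k) sums (side (Suc j) * (1 / 2) ^ Suc j * 2)"
    using geometric_sums[of "1 / 2 :: real"] by (intro sums_mult) simp
  have "\<bar>\<Sum>k. D (k + Suc j)\<bar> \<le> (\<Sum>k. side (Suc j) * (1 / 2) ^ Suc j * (1 / 2) ^ k)"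
    using norm_suminf_le[of "\<lambda>k. D (k + Suc j)" "\<lambda>k. side (Suc j) * (1 / 2) ^ Suc j * (1 / 2) ^ k"]
      Dk sums_summable[OF geo] by simp
  also have "\<dots> = side (Suc j) * (1 / 2) ^ j" using sums_unique[OF geo] by simp
  finally have "\<bar>D j\<bar> - side (Suc j) * (1 / 2) ^ j \<le> \<bar>coord i s - coord i t\<bar>"
    unfolding split by linarith
  moreover have "\<bar>D j\<bar> - side (Suc j) * (1 / 2) ^ j = r j"
    unfolding Dj side_Suc[of j] by (simp add: add_divide_distrib power_one_over)
  ultimately show ?thesis by simp
qed

end

text \<open>
  If the first digits in which \<open>s\<close> and \<open>t\<close> differ belong to generation \<open>j\<close>, then \<open>s\<close> and \<open>t\<close> share the first \<open>j * d\<close>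
  digits, while their images are separated by a gap of that generation.
\<close>
lemma cantor_embedding:
  fixes r :: "nat \<Rightarrow> real"
  assumes r: "\<And>j. 0 < r j" and summable: "summable (\<lambda>j. 2 ^ j * r j)"
  obtains x :: "real \<Rightarrow> 'a::euclidean_space"
  where "\<And>s t. s \<in> {0..<1} \<Longrightarrow> t \<in> {0..<1} \<Longrightarrow> s \<noteq> t \<Longrightarrow>
    \<exists>j. \<bar>s - t\<bar> \<le> (1 / 2) ^ (j * DIM('a)) \<and> r j \<le> dist (x s) (x t)"
proof -
  define d where "d = DIM('a)"
  have d: "0 < d" unfolding d_def by simp
  obtain e :: "nat \<Rightarrow> 'a" where e: "bij_betw e {..<d} Basis"
    using finite_same_card_bij[of "{..<d}" "Basis :: 'a set"] unfolding d_def by auto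
  have eB: "e i \<in> Basis" if "i < d" for i using e that unfolding bij_betw_def by auto
  define x :: "real \<Rightarrow> 'a" where "x s = (\<Sum>i<d. coord r d i s *\<^sub>R e i)" for s
  have inner: "x s \<bullet> e i = coord r d i s" if "i < d" for s i
  proof -
    have "x s \<bullet> e i = (\<Sum>k<d. coord r d k s * (e k \<bullet> e i))" unfolding x_def by (simp add: inner_sum_left)
    also have "\<dots> = (\<Sum>k<d. if k = i then coord r d k s else 0)"
    proof (intro sum.cong refl)
      fix k assume "k \<in> {..<d}"
      moreover have "e k = e i \<longleftrightarrow> k = i"
        using e that \<open>k \<in> {..<d}\<close> unfolding bij_betw_def inj_on_def by auto
      ultimately show "coord r d k s * (e k \<bullet> e i) = (if k = i then coord r d k s else 0)"
        using eB that by (simp add: inner_Basis)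
    qed
    also have "\<dots> = coord r d i s" using that by simp
    finally show ?thesis .
  qed
  have "\<exists>j. \<bar>s - t\<bar> \<le> (1 / 2) ^ (j * d) \<and> r j \<le> dist (x s) (x t)"
    if st: "s \<in> {0..<1}" "t \<in> {0..<1}" "s \<noteq> t" for s t
  proof -
    obtain m where m: "binary_digit m s \<noteq> binary_digit m t" "\<And>k. k < m \<Longrightarrow> binary_digit k s = binary_digit k t"
      by (rule first_differing_bit[OF st]) blast
    define j i where "j = m div d" and "i = m mod d"
    have ji: "j * d + i = m" "i < d" unfolding j_def i_def using d by auto
    have "\<bar>s - t\<bar> < (1 / 2) ^ m" by (rule dist_less_if_bits_eq[OF st(1,2) m(2)])
    also have "(1 / 2 :: real) ^ m \<le> (1 / 2) ^ (j * d)" using ji by (intro power_decreasing) auto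
    finally have "\<bar>s - t\<bar> \<le> (1 / 2) ^ (j * d)" by simp
    moreover have "r j \<le> \<bar>coord r d i s - coord r d i t\<bar>"
      using m ji by (intro coord_diff_ge d r summable) auto
    moreover have "coord r d i s - coord r d i t = (x s - x t) \<bullet> e i"
      by (simp add: inner_diff_left inner ji)
    moreover have "\<bar>(x s - x t) \<bullet> e i\<bar> \<le> dist (x s) (x t)"
      unfolding dist_norm by (rule Basis_le_norm[OF eB[OF ji(2)]])
    ultimately show ?thesis by (metis order_trans)
  qed
  then show ?thesis unfolding d_def by (rule that)
qed

context modulus
begin

text \<open>
  The last property is the bound \<open>\<omega> (2 * r) \<le> 2^d * \<omega> r\<close> read backwards. Starting from \<open>r 0 = 1/2\<close> keeps all radii
  inside the interval of integration.
\<close>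
lemma radii:
  obtains r where "\<And>j. 0 < r j" "r 0 = 1 / 2" "\<And>j. \<omega> (r j) = \<omega> (1 / 2) * (1 / 2) ^ (j * d)"
    "\<And>j. 2 * r (Suc j) \<le> r j"
proof -
  define c where "c = \<omega> (1 / 2)"
  have c: "0 < c" unfolding c_def by (rule pos) simp
  have "\<exists>x. 0 \<le> x \<and> x \<le> 1 / 2 \<and> \<omega> x = c * (1 / 2) ^ (j * d)" for j
  proof (rule IVT')
    show "\<omega> 0 \<le> c * (1 / 2) ^ (j * d)" using c by simp
    show "c * (1 / 2) ^ (j * d) \<le> \<omega> (1 / 2)" unfolding c_def[symmetric] using c
      by (intro mult_left_le power_le_one) auto
    show "continuous_on {0..1 / 2} \<omega>" by (rule continuous_on_subset[OF cont]) auto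
  qed simp
  then obtain r where r: "\<And>j. 0 \<le> r j" "\<And>j. \<omega> (r j) = c * (1 / 2) ^ (j * d)" by metis
  have rpos: "0 < r j" for j
  proof (rule ccontr)
    assume "\<not> 0 < r j"
    then have "r j = 0" using r(1)[of j] by simp
    then show False using r(2)[of j] c by simp
  qed
  show ?thesis
  proof (rule that[of r])
    show "r 0 = 1 / 2"
      using le_imp_le[of "r 0" "1 / 2"] le_imp_le[of "1 / 2" "r 0"] r(1)[of 0] r(2)[of 0]
      unfolding c_def by simp
    show "2 * r (Suc j) \<le> r j" for j
    proof (rule le_imp_le)
      have "\<omega> (2 * r (Suc j)) \<le> 2 ^ d * \<omega> (r (Suc j))" using growth[of 2 "r (Suc j)"] r(1) by simp
      also have "\<dots> = \<omega> (r j)" unfolding r(2) by (simp add: power_add power_one_over)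
      finally show "\<omega> (2 * r (Suc j)) \<le> \<omega> (r j)" .
    qed (use r(1) in auto)
  qed (use rpos r(2) c_def in auto)
qed

text \<open>
  Between \<open>r (j+1)\<close> and \<open>r j\<close>, an interval of length at least \<open>r j / 2\<close>, the integrand is at least a constant
  times \<open>2^j\<close>.
\<close>
lemma summable_radii:
  assumes fin: "(\<integral>\<^sup>+t\<in>{0<..<1}. ennreal (\<omega> t powr (- 1 / real d)) \<partial>lborel) < \<infinity>"
    and r: "\<And>j. 0 < r j" "r 0 = 1 / 2" "\<And>j. \<omega> (r j) = \<omega> (1 / 2) * (1 / 2) ^ (j * d)"
      "\<And>j. 2 * r (Suc j) \<le> r j"
  shows "summable (\<lambda>j. 2 ^ j * r j)"
proof -
  define c where "c = \<omega> (1 / 2) powr (- 1 / real d)"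
  define I where "I = (\<integral>\<^sup>+t\<in>{0<..<1}. ennreal (\<omega> t powr (- 1 / real d)) \<partial>lborel)"
  have c: "0 < c" unfolding c_def using pos[of "1 / 2"] by simp
  have anti: "r (Suc j) \<le> r j" for j using r(4)[of j] r(1)[of "Suc j"] by linarith
  then have half: "r j \<le> 1 / 2" for j using lift_Suc_antimono_le[of r 0 j] r(2) by simp
  \<comment> \<open>Truncating the argument makes the integrand measurable on the whole line without changing the integrals.\<close>
  define h where "h t = ennreal (\<omega> (max t 0) powr (- 1 / real d))" for t
  have [measurable]: "h \<in> borel_measurable borel"
  proof -
    have "continuous_on UNIV (\<lambda>t. \<omega> (max t 0))"
      by (intro continuous_on_compose2[OF cont] continuous_intros) auto
    then have [measurable]: "(\<lambda>t. \<omega> (max t 0)) \<in> borel_measurable borel"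
      by (rule borel_measurable_continuous_onI)
    show ?thesis unfolding h_def by measurable
  qed
  have step: "ennreal (c / 2 * (2 ^ j * r j)) \<le> (\<integral>\<^sup>+t\<in>{r (Suc j)<..r j}. h t \<partial>lborel)" for j
  proof -
    have "\<omega> (r j) powr (- 1 / real d) = c * 2 ^ j"
    proof -
      have "((1 / 2 :: real) ^ (j * d)) powr (- 1 / real d) = 2 ^ j"
        using d_ge_2 by (simp add: powr_realpow[symmetric] powr_powr powr_minus_divide powr_divide powr_one_eq_one flip: power_one_over)
      then show ?thesis unfolding r(3) c_def using pos[of "1 / 2"] by (subst powr_mult) auto
    qed
    then have le: "c * 2 ^ j \<le> \<omega> t powr (- 1 / real d)" if "r (Suc j) < t" "t \<le> r j" for t
      using that r(1)[of "Suc j"] mono[of t "r j"] pos[of t] powr_mono2'[of "- 1 / real d" "\<omega> t" "\<omega> (r j)"] by auto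
    have "ennreal (c / 2 * (2 ^ j * r j)) \<le> ennreal (c * 2 ^ j * (r j - r (Suc j)))"
    proof (intro ennreal_leI)
      have "r j / 2 \<le> r j - r (Suc j)" using r(4)[of j] by simp
      then have "c * 2 ^ j * (r j / 2) \<le> c * 2 ^ j * (r j - r (Suc j))"
        using c by (intro mult_left_mono) auto
      then show "c / 2 * (2 ^ j * r j) \<le> c * 2 ^ j * (r j - r (Suc j))" by simp
    qed
    also have "\<dots> = ennreal (c * 2 ^ j) * emeasure lborel {r (Suc j)<..r j}"
      using anti[of j] c by (simp add: ennreal_mult'')
    also have "\<dots> = (\<integral>\<^sup>+t. ennreal (c * 2 ^ j) * indicator {r (Suc j)<..r j} t \<partial>lborel)"
      by (rule nn_integral_cmult_indicator[symmetric]) simp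
    also have "\<dots> \<le> (\<integral>\<^sup>+t\<in>{r (Suc j)<..r j}. h t \<partial>lborel)"
    proof (intro nn_integral_mono)
      fix t
      show "ennreal (c * 2 ^ j) * indicator {r (Suc j)<..r j} t \<le> h t * indicator {r (Suc j)<..r j} t"
        using le[of t] r(1)[of "Suc j"] unfolding h_def
        by (auto simp: indicator_def max_def intro!: ennreal_leI)
    qed
    finally show ?thesis .
  qed
  have partial: "ennreal (\<Sum>j<n. c / 2 * (2 ^ j * r j)) \<le> (\<integral>\<^sup>+t\<in>{r n<..1 / 2}. h t \<partial>lborel)" for n
  proof (induction n)
    case (Suc n)
    have nn: "0 \<le> c / 2 * (2 ^ j * r j)" for j using c r(1)[of j] by simp
    have "ennreal (\<Sum>j<Suc n. c / 2 * (2 ^ j * r j))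
      = ennreal (\<Sum>j<n. c / 2 * (2 ^ j * r j)) + ennreal (c / 2 * (2 ^ n * r n))"
      using nn by (simp only: sum.lessThan_Suc ennreal_plus sum_nonneg)
    also have "\<dots> \<le> (\<integral>\<^sup>+t\<in>{r n<..1 / 2}. h t \<partial>lborel) + (\<integral>\<^sup>+t\<in>{r (Suc n)<..r n}. h t \<partial>lborel)"
      by (intro add_mono Suc.IH step)
    also have "\<dots> = (\<integral>\<^sup>+t. h t * indicator {r n<..1 / 2} t + h t * indicator {r (Suc n)<..r n} t \<partial>lborel)"
      by (rule nn_integral_add[symmetric]) measurable
    also have "\<dots> = (\<integral>\<^sup>+t\<in>{r (Suc n)<..1 / 2}. h t \<partial>lborel)"
      using anti[of n] half[of n] by (intro nn_integral_cong) (auto simp: indicator_def)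
    finally show ?case .
  qed simp
  have bound: "(\<Sum>j<n. 2 ^ j * r j) \<le> 2 / c * enn2real I" for n
  proof -
    have "(\<integral>\<^sup>+t\<in>{r n<..1 / 2}. h t \<partial>lborel) \<le> I"
      unfolding I_def h_def using r(1)[of n]
      by (intro nn_integral_mono) (auto simp: indicator_def max_def)
    with partial[of n] have "ennreal (\<Sum>j<n. c / 2 * (2 ^ j * r j)) \<le> I" by (rule order_trans)
    moreover have "I = ennreal (enn2real I)" using fin unfolding I_def by simp
    ultimately have "ennreal (\<Sum>j<n. c / 2 * (2 ^ j * r j)) \<le> ennreal (enn2real I)" by simp
    then have "(\<Sum>j<n. c / 2 * (2 ^ j * r j)) \<le> enn2real I"
      by (subst (asm) ennreal_le_iff) auto
    then have "c / 2 * (\<Sum>j<n. 2 ^ j * r j) \<le> enn2real I" by (simp only: sum_distrib_left)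
    then show ?thesis using c by (simp add: field_simps)
  qed
  show ?thesis
    using r(1) by (intro summableI_nonneg_bounded[OF _ bound]) (simp add: less_imp_le)
qed

lemma image_not_null_if_integral_finite:
  assumes dim: "DIM('a::euclidean_space) = d"
    and fin: "(\<integral>\<^sup>+t\<in>{0<..<1}. ennreal (\<omega> t powr (- 1 / real d)) \<partial>lborel) < \<infinity>"
  obtains A :: "'a::euclidean_space set" and f :: "'a::euclidean_space \<Rightarrow> real"
  where "has_modulus_of_continuity f A \<omega>" "f ` A \<notin> null_sets lebesgue"
proof -
  define c where "c = \<omega> (1 / 2)"
  have c: "0 < c" unfolding c_def by (rule pos) simp
  obtain r where r: "\<And>j. 0 < r j" "r 0 = 1 / 2" "\<And>j. \<omega> (r j) = \<omega> (1 / 2) * (1 / 2) ^ (j * d)"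
      "\<And>j. 2 * r (Suc j) \<le> r j" by (rule radii) blast
  obtain x :: "real \<Rightarrow> 'a" where x: "\<And>s t. s \<in> {0..<1} \<Longrightarrow> t \<in> {0..<1} \<Longrightarrow> s \<noteq> t \<Longrightarrow>
    \<exists>j. \<bar>s - t\<bar> \<le> (1 / 2) ^ (j * DIM('a)) \<and> r j \<le> dist (x s) (x t)"
    using cantor_embedding[OF r(1) summable_radii[OF fin r]] by blast
  have inj: "inj_on x {0..<1}"
  proof (rule inj_onI, rule ccontr)
    fix s t assume "s \<in> {0..<1}" "t \<in> {0..<1}" "x s = x t" "s \<noteq> t"
    then obtain j where "r j \<le> 0" using x[of s t] by auto
    with r(1)[of j] show False by simp
  qed
  define f where "f z = c * inv_into {0..<1} x z" for z
  have fx: "f (x s) = c * s" if "s \<in> {0..<1}" for s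
    unfolding f_def using inj that by simp
  show ?thesis
  proof (rule that[of f "x ` {0..<1}"])
    show "has_modulus_of_continuity f (x ` {0..<1}) \<omega>"
      unfolding has_modulus_of_continuity_def
    proof (intro ballI)
      fix u w assume "u \<in> x ` {0..<1}" "w \<in> x ` {0..<1}"
      then obtain s t where st: "s \<in> {0..<1}" "t \<in> {0..<1}" "u = x s" "w = x t" by auto
      show "\<bar>f u - f w\<bar> \<le> \<omega> (dist u w)"
      proof (cases "s = t")
        case False
        then obtain j where j: "\<bar>s - t\<bar> \<le> (1 / 2) ^ (j * d)" "r j \<le> dist (x s) (x t)"
          using x[OF st(1,2)] unfolding dim by blast
        have "\<bar>f u - f w\<bar> = c * \<bar>s - t\<bar>"
          unfolding st(3,4) fx[OF st(1)] fx[OF st(2)] right_diff_distrib[symmetric] abs_mult using c by simp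
        also have "\<dots> \<le> c * (1 / 2) ^ (j * d)" using j c by (intro mult_left_mono) auto
        also have "\<dots> = \<omega> (r j)" unfolding r(3) c_def ..
        also have "\<dots> \<le> \<omega> (dist u w)" unfolding st using j r(1)[of j] by (intro mono) auto
        finally show ?thesis .
      qed (simp add: st)
    qed
    have "f ` x ` {0..<1} = (\<lambda>s. c * s) ` {0..<1}"
      unfolding image_image using fx by (intro image_cong) auto
    also have "\<dots> = {0..<c}"
    proof safe
      fix s assume "s \<in> {0..<1::real}"
      then show "c * s \<in> {0..<c}" using c by auto
    next
      fix s assume "s \<in> {0..<c}"
      then show "s \<in> (\<lambda>s. c * s) ` {0..<1}" using c by (intro image_eqI[of _ _ "s / c"]) auto
    qed
    finally show "f ` x ` {0..<1} \<notin> null_sets lebesgue"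
      using c by (simp add: null_sets_def)
  qed
qed

end

section \<open>The equivalence\<close>

theorem theorem1:
  fixes \<omega> :: "real \<Rightarrow> real"
  assumes "CARD('n::finite) \<ge> 2"
    and "\<omega> \<in> {0..} \<rightarrow> {0..}"
    and "continuous_on {0..} \<omega>"
    and "strict_mono_on {0..} \<omega>"
    and "convex_on {0..} \<omega>"
    and "\<omega> 0 = 0"
    and "antimono_on {0<..} (\<lambda>r. \<omega> r / r ^ CARD('n))"
  shows "(\<forall>(A :: (real ^ 'n) set) (f :: real ^ 'n \<Rightarrow> real).
            has_modulus_of_continuity f A \<omega> \<longrightarrow> f ` A \<in> null_sets lebesgue)
         \<longleftrightarrow> (\<integral>\<^sup>+ r\<in>{0<..<1}. ennreal (\<omega> r powr (- 1 / real CARD('n))) \<partial>lborel) = \<infinity>"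
proof -
  interpret modulus \<omega> "CARD('n)"
    using assms by unfold_locales auto
  have dim: "DIM(real ^ 'n) = CARD('n)" by simp
  let ?I = "\<integral>\<^sup>+ r\<in>{0<..<1}. ennreal (\<omega> r powr (- 1 / real CARD('n))) \<partial>lborel"
  show ?thesis
  proof
    assume null: "\<forall>(A :: (real ^ 'n) set) f. has_modulus_of_continuity f A \<omega> \<longrightarrow> f ` A \<in> null_sets lebesgue"
    show "?I = \<infinity>"
    proof (rule ccontr)
      assume "?I \<noteq> \<infinity>"
      then have "?I < \<infinity>" by (simp add: less_top)
      then obtain A and f :: "real ^ 'n \<Rightarrow> real"
        where "has_modulus_of_continuity f A \<omega>" "f ` A \<notin> null_sets lebesgue"
        by (rule image_not_null_if_integral_finite[OF dim])
      with null show False by blast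
    qed
  next
    assume "?I = \<infinity>"
    then show "\<forall>(A :: (real ^ 'n) set) f. has_modulus_of_continuity f A \<omega> \<longrightarrow> f ` A \<in> null_sets lebesgue"
      using summable_weight_if_image_not_null[OF dim] integral_finite_if_summable by fastforce
  qed
qed

end
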